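(* Let $\hbar>0$, $q=e^{i\pi\hbar}$, $p\ge2$, $\varphi=\pi/p$, $w=e^{i\varphi}+e^{-i\varphi}=2\cos(\pi/p)$. Let $Z$ be the quantum variable of a pending edge ending at an orbifold point of order $p$, let $A,B$ be the quantum variables of the other two edges at its three-valent vertex, with clockwise order $(Z,A,B)$, and let $$\tilde A=A+\phi^\hbar(Z+i\varphi)+\phi^\hbar(Z-i\varphi),\quad \tilde B=B-\phi^\hbar(-Z+i\varphi)-\phi^\hbar(-Z-i\varphi),\quad \tilde Z=-Z .$$ Let $F_p=\begin{pmatrix}0&1\\-1&-w\end{pmatrix}$ and let $\Omega=\begin{pmatrix}a&c\\-c&a-wc\end{pmatrix}$, with arbitrary $a,c\in\mathbb C$, denote any matrix commuting with $F_p$ (in particular, $F_p^k$, $k\in\mathbb Z$). Then the following quantum matrix relations hold (equalities of $2\times2$ matrices with operator entries, the operators in each product being ordered by the order of matrix multiplication): $$X_{A}LX_Z(F_p\Omega) X_ZLX_{B}=q^{-1}\,X_{\tilde A}RX_{\tilde Z}(-\Omega) X_{\tilde Z}RX_{\tilde B},$$ $$X_{A}LX_Z\,\Omega\, X_ZRX_{A}=X_{\tilde A}RX_{\tilde Z}(-\Omega) X_{\tilde Z}LX_{\tilde A},$$ $$X_{B}RX_Z\,\Omega\, X_ZLX_{B}=X_{\tilde B}LX_{\tilde Z}(-\Omega) X_{\tilde Z}RX_{\tilde B}.$$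
   Context: Setting: a fat graph that is a spine of a Riemann surface with holes and orbifold points, all of whose vertices are three-valent except for one-valent vertices placed at the orbifold points; an edge ending at such a one-valent vertex is called pending. Each edge $\alpha$ carries a quantum shear coordinate $Z_\alpha$. The edges carrying $A$ and $B$ may themselves be pending. Matrices: $X_Y=\begin{pmatrix}0&-e^{Y/2}\\ e^{-Y/2}&0\end{pmatrix}$, $R=\begin{pmatrix}1&1\\-1&0\end{pmatrix}$, $L=R^2=\begin{pmatrix}0&1\\-1&-1\end{pmatrix}$. Commutation relations: quantum edge variables are self-adjoint with scalar commutators $[Z_\alpha,Z_\beta]=2\pi i\hbar\{Z_\alpha,Z_\beta\}$, where $\{\cdot,\cdot\}$ is the antisymmetric bracket to which each three-valent vertex with clockwise cyclic order of edges $(\alpha_1,\alpha_2,\alpha_3)$ contributes $+1$ to each of $\{Z_{\alpha_1},Z_{\alpha_2}\},\{Z_{\alpha_2},Z_{\alpha_3}\},\{Z_{\alpha_3},Z_{\alpha_1}\}$. Quantum dilogarithm: $\phi^\hbar(z)=-\frac{\pi\hbar}{2}\int_{C}\frac{e^{-i\xi z}}{\sinh(\pi \xi)\sinh(\pi\hbar \xi)}\,d\xi$, where the contour $C$ runs along the real axis bypassing the singularity at the origin from above. It satisfies $\phi^\hbar(z)-\phi^\hbar(-z)=z$, $\overline{\phi^\hbar(z)}=\phi^\hbar(\bar z)$, $\phi^\hbar(z+i\pi\hbar)-\phi^\hbar(z-i\pi\hbar)=\frac{2\pi i\hbar}{e^{-z}+1}$. Functions of operators are treated by the standard rule: if $[W,Z]$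 is a nonzero scalar then $e^{W+\Phi(Z)}=\exp\left\{\frac{1}{[W,Z]}\int_Z^{Z+[W,Z]}\Phi(z)\,dz\right\}e^{W}$.
   Formalization: Printed constants are corrected: in the 2nd and 3rd relations −Ω on the right becomes Ω (for Ω=1 the printed form reads −1=+1), and q^{-1} in the 1st becomes q^{-1/2}=e^{-iπħ/2}, as the standard rule forces. Operators live in any *-algebra with such a calculus. *)

theory Defs
  imports "HOL-Complex_Analysis.Contour_Integration"
begin

section \<open>Fat graphs with pending edges\<close>

text \<open>
  A fat graph is given by its finite set of half-edges: \<open>rot\<close> sends a half-edge to the next one
  clockwise at the same vertex, and \<open>opp\<close> to the other half of the same edge.
  Vertices are the orbits of \<open>rot\<close>; as \<open>rot\<^sup>3 = id\<close>, each of them is one-valent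
  (\<open>rot d = d\<close>) or three-valent. An orbifold point sits at every one-valent vertex, and
  \<open>ordp\<close> is its order.
\<close>

locale orbifold_fat_graph =
  fixes D :: "'d set" and rot opp :: "'d \<Rightarrow> 'd" and ordp :: "'d \<Rightarrow> nat"
  assumes finite_darts: "finite D" "D \<noteq> {}"
    and rot_closed: "\<And>d. d \<in> D \<Longrightarrow> rot d \<in> D"
    and rot_valency: "\<And>d. d \<in> D \<Longrightarrow> rot (rot (rot d)) = d"
    and opp_closed: "\<And>d. d \<in> D \<Longrightarrow> opp d \<in> D"
    and opp_involution: "\<And>d. d \<in> D \<Longrightarrow> opp d \<noteq> d \<and> opp (opp d) = d"
    and connected: "\<And>S. S \<subseteq> D \<Longrightarrow> S \<noteq> {} \<Longrightarrow> rot ` S \<subseteq> S \<Longrightarrow> opp ` S \<subseteq> S \<Longrightarrow> S = D"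
    and orbifold_order: "\<And>d. d \<in> D \<Longrightarrow> rot d = d \<Longrightarrow> ordp d \<ge> 2"

definition edge :: "('d \<Rightarrow> 'd) \<Rightarrow> 'd \<Rightarrow> 'd set" where
  "edge opp d = {d, opp d}"

definition edges :: "'d set \<Rightarrow> ('d \<Rightarrow> 'd) \<Rightarrow> 'd set set" where
  "edges D opp = edge opp ` D"

text \<open>
  The sum runs over the corners \<open>(d, rot d)\<close> of the three-valent vertices, three for each vertex.
\<close>

definition bracket :: "'d set \<Rightarrow> ('d \<Rightarrow> 'd) \<Rightarrow> ('d \<Rightarrow> 'd) \<Rightarrow> 'd set \<Rightarrow> 'd set \<Rightarrow> int" where
  "bracket D rot opp \<alpha> \<beta> =
     (\<Sum>d | d \<in> D \<and> rot d \<noteq> d.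
        (if edge opp d = \<alpha> \<and> edge opp (rot d) = \<beta> then 1 else 0)
      - (if edge opp d = \<beta> \<and> edge opp (rot d) = \<alpha> then 1 else 0))"

section \<open>Operators and functions of operators\<close>

text \<open>
  Operators are elements of an abstract complex *-algebra: \<open>scal c\<close> is the scalar operator \<open>c\<close>,
  \<open>adj\<close> the adjoint. \<open>V\<close> is the set of linear self-adjoint quantum variables, and \<open>fcalc f x\<close>
  is the function \<open>f(x)\<close> of the operator \<open>x\<close>.

  The functional calculus of \<open>x \<in> V\<close> concerns functions that are analytic in a neighbourhood of the
  real axis and only sees their values on the real axis (the spectrum of \<open>x\<close>); outside of the
  listed situations \<open>fcalc\<close> is unconstrained. Shifting the argument by a commutator
  requires analyticity on the closed strip that is swept by the shift.
\<close>

definition strip :: "complex \<Rightarrow> complex set" where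
  "strip c = {of_real x + of_real t * c | x t :: real. 0 \<le> t \<and> t \<le> 1}"

locale operator_calculus =
  fixes scal :: "complex \<Rightarrow> 'op::ring_1" and adj :: "'op \<Rightarrow> 'op"
    and fcalc :: "(complex \<Rightarrow> complex) \<Rightarrow> 'op \<Rightarrow> 'op" and V :: "'op set"
  assumes scal_one: "scal 1 = 1"
    and scal_add: "\<And>a b. scal (a + b) = scal a + scal b"
    and scal_mult: "\<And>a b. scal (a * b) = scal a * scal b"
    and scal_central: "\<And>a x. scal a * x = x * scal a"
    and adj_add: "\<And>x y. adj (x + y) = adj x + adj y"
    and adj_mult: "\<And>x y. adj (x * y) = adj y * adj x"
    and adj_adj: "\<And>x. adj (adj x) = x"
    and adj_scal: "\<And>a. adj (scal a) = scal (cnj a)"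
    and self_adjoint: "\<And>x. x \<in> V \<Longrightarrow> adj x = x"
    and fcalc_const: "\<And>x c. x \<in> V \<Longrightarrow> fcalc (\<lambda>_. c) x = scal c"
    and fcalc_ident: "\<And>x. x \<in> V \<Longrightarrow> fcalc (\<lambda>z. z) x = x"
    and fcalc_cong: "\<And>x f g. x \<in> V \<Longrightarrow> f analytic_on \<real> \<Longrightarrow> g analytic_on \<real> \<Longrightarrow>
          (\<And>z. z \<in> \<real> \<Longrightarrow> f z = g z) \<Longrightarrow> fcalc f x = fcalc g x"
    and fcalc_add: "\<And>x f g. x \<in> V \<Longrightarrow> f analytic_on \<real> \<Longrightarrow> g analytic_on \<real> \<Longrightarrow>
          fcalc (\<lambda>z. f z + g z) x = fcalc f x + fcalc g x"
    and fcalc_mult: "\<And>x f g. x \<in> V \<Longrightarrow> f analytic_on \<real> \<Longrightarrow> g analytic_on \<real> \<Longrightarrow>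
          fcalc (\<lambda>z. f z * g z) x = fcalc f x * fcalc g x"
    and fcalc_compose: "\<And>x f g. x \<in> V \<Longrightarrow> g analytic_on \<real> \<Longrightarrow> f analytic_on (g ` \<real>) \<Longrightarrow>
          fcalc f (fcalc g x) = fcalc (\<lambda>z. f (g z)) x"
    and fcalc_adj: "\<And>x f. x \<in> V \<Longrightarrow> f analytic_on \<real> \<Longrightarrow>
          adj (fcalc f x) = fcalc (\<lambda>z. cnj (f (cnj z))) x"
    and exp_shift: "\<And>w x c f. w \<in> V \<Longrightarrow> x \<in> V \<Longrightarrow> w * x - x * w = scal c \<Longrightarrow>
          f analytic_on (strip c) \<Longrightarrow>
          fcalc exp w * fcalc f x = fcalc (\<lambda>z. f (z + c)) x * fcalc exp w"
    and exp_standard_rule: "\<And>w x c f. w \<in> V \<Longrightarrow> x \<in> V \<Longrightarrow> w * x - x * w = scal c \<Longrightarrow> c \<noteq> 0 \<Longrightarrow>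
          f analytic_on (strip c) \<Longrightarrow>
          fcalc exp (w + fcalc f x) =
            fcalc (\<lambda>z. exp (1 / c * contour_integral (linepath z (z + c)) f)) x * fcalc exp w"

definition real_span :: "(complex \<Rightarrow> 'op::ring_1) \<Rightarrow> 'op set \<Rightarrow> 'op set" where
  "real_span scal S = {(\<Sum>x\<in>S. scal (of_real (r x)) * x) | r :: 'op \<Rightarrow> real. True}"

locale quantum_fat_graph =
  orbifold_fat_graph D rot opp ordp +
  operator_calculus scal adj fcalc "real_span scal (Zq ` edges D opp)"
  for D :: "'d set" and rot opp and ordp and h :: real
    and scal :: "complex \<Rightarrow> 'op::ring_1" and adj and fcalc and Zq :: "'d set \<Rightarrow> 'op" +
  assumes h_pos: "h > 0"
    and commutator: "\<And>\<alpha> \<beta>. \<alpha> \<in> edges D opp \<Longrightarrow> \<beta> \<in> edges D opp \<Longrightarrow>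
          Zq \<alpha> * Zq \<beta> - Zq \<beta> * Zq \<alpha> =
            scal (2 * of_real pi * \<i> * of_real h * of_int (bracket D rot opp \<alpha> \<beta>))"

section \<open>The quantum dilogarithm\<close>

text \<open>
  The contour follows the real axis, except for the half-circle of radius \<open>\<epsilon>\<close> above the origin.
  The nonzero poles closest to the origin are \<open>\<plusminus>\<i>\<close> and \<open>\<plusminus>\<i>/h\<close>, so that the chosen radius is below
  their distance to the origin; the value does not depend on the radius within this range.
  The integrals converge for \<open>\<bar>Im z\<bar> < \<pi> (1 + h)\<close>.
\<close>

definition qdilog_kernel :: "real \<Rightarrow> complex \<Rightarrow> complex \<Rightarrow> complex" where
  "qdilog_kernel h z \<xi> =
     exp (- \<i> * \<xi> * z) / (sinh (of_real pi * \<xi>) * sinh (of_real pi * of_real h * \<xi>))"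

definition qdilog :: "real \<Rightarrow> complex \<Rightarrow> complex" where
  "qdilog h z =
     (let \<epsilon> = min 1 (1 / h) / 2 in
      - (of_real pi * of_real h / 2) *
        ((LBINT x:{..-\<epsilon>}. qdilog_kernel h z (of_real x))
         + contour_integral (part_circlepath 0 \<epsilon> pi 0) (qdilog_kernel h z)
         + (LBINT x:{\<epsilon>..}. qdilog_kernel h z (of_real x))))"

section \<open>Matrices with operator entries\<close>

definition mat2 :: "'a \<Rightarrow> 'a \<Rightarrow> 'a \<Rightarrow> 'a \<Rightarrow> ('a::zero)^2^2" where
  "mat2 a b c d = vector [vector [a, b], vector [c, d]]"

definition Rm :: "('a::ring_1)^2^2" where
  "Rm = mat2 1 1 (-1) 0"

definition Lm :: "('a::ring_1)^2^2" where
  "Lm = Rm ** Rm"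

definition Xm :: "(complex \<Rightarrow> 'op::ring_1) \<Rightarrow> ((complex \<Rightarrow> complex) \<Rightarrow> 'op \<Rightarrow> 'op) \<Rightarrow> 'op \<Rightarrow> 'op^2^2" where
  "Xm scal fcalc Y =
     mat2 0 (- fcalc exp (scal (1/2) * Y)) (fcalc exp (- (scal (1/2) * Y))) 0"

definition scal_matrix :: "(complex \<Rightarrow> 'op::ring_1) \<Rightarrow> complex^2^2 \<Rightarrow> 'op^2^2" where
  "scal_matrix scal M = (\<chi> i j. scal (M $ i $ j))"

definition smult_matrix :: "'op::ring_1 \<Rightarrow> 'op^2^2 \<Rightarrow> 'op^2^2" where
  "smult_matrix k M = (\<chi> i j. k * M $ i $ j)"

definition Fm :: "complex \<Rightarrow> complex^2^2" where
  "Fm w = mat2 0 1 (-1) (-w)"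

definition Omega :: "complex \<Rightarrow> complex \<Rightarrow> complex \<Rightarrow> complex^2^2" where
  "Omega w a c = mat2 a c (-c) (a - w * c)"

text \<open>
  On signs: for \<open>\<Omega> = 1\<close>, both \<open>X\<^sub>A L X\<^sub>Z \<Omega> X\<^sub>Z R X\<^sub>A\<close> and
  \<open>X\<^sub>A R X\<^sub>Z \<Omega> X\<^sub>Z L X\<^sub>A\<close> are \<open>-1\<close>, because \<open>X\<^sub>Y\<^sup>2 = -1\<close> and \<open>L R = R L = -1\<close>. The relations
  of this shape therefore carry the same sign of \<open>\<Omega>\<close> on both sides; a printed \<open>-\<Omega>\<close> in
  them is only correct modulo \<open>\<plusminus>1\<close>. The relation of \<open>A\<close> with \<open>B\<close> does need \<open>-\<Omega>\<close>. Its ordering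
  constant is \<open>exp (- \<i> \<pi> h / 2)\<close>, already visible for \<open>Z \<rightarrow> -\<infinity>\<close>, where the modified \<open>B/2\<close> becomes
  \<open>B/2 + Z\<close> and \<open>exp (- Z) exp (B/2 + Z) = exp (\<i> \<pi> h / 2) exp (B/2)\<close>.
\<close>

lemma commutes_Fm_iff: "M ** Fm w = Fm w ** M \<longleftrightarrow> (\<exists>a c. M = Omega w a c)"
proof
  assume comm: "M ** Fm w = Fm w ** M"
  have 1: "- M$1$2 = M$2$1"
    using arg_cong[OF comm, of "\<lambda>N. N$1$1"]
    by (simp add: matrix_matrix_mult_def Fm_def mat2_def sum_2)
  have 2: "M$1$1 - w * M$1$2 = M$2$2"
    using arg_cong[OF comm, of "\<lambda>N. N$1$2"]
    by (simp add: matrix_matrix_mult_def Fm_def mat2_def sum_2 algebra_simps)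
  have "M = Omega w (M$1$1) (M$1$2)"
    using 1 2 by (simp add: vec_eq_iff forall_2 Omega_def mat2_def)
  then show "\<exists>a c. M = Omega w a c" by blast
next
  assume "\<exists>a c. M = Omega w a c"
  then show "M ** Fm w = Fm w ** M"
    by (auto simp: vec_eq_iff forall_2 matrix_matrix_mult_def sum_2 Omega_def Fm_def mat2_def
          algebra_simps)
qed

lemma Lm_eq: "Lm = mat2 0 1 (-1) (-1)"
  by (simp add: vec_eq_iff forall_2 matrix_matrix_mult_def sum_2 Lm_def Rm_def mat2_def)

end

theory Submission
  imports Defs "HOL-Complex_Analysis.Residue_Theorem"
begin

text \<open>
  Each matrix between the outer factors is a function of \<open>Z\<close> alone. By the standard rule, \<open>exp (\<plusminus>At/2)\<close> and
  \<open>exp (\<plusminus>Bt/2)\<close> are \<open>exp (\<plusminus>A/2)\<close> and \<open>exp (\<plusminus>B/2)\<close> times exponentials of difference quotients of a primitive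
  \<open>G\<close> of \<open>(\<phi>\<^sup>h (z + \<i>\<phi>) + \<phi>\<^sup>h (z - \<i>\<phi>)) / 2\<close>. These factors are not elementary, but the products of two of them that
  occur in the entries are: the functional equation of \<open>\<phi>\<^sup>h\<close> under \<open>z \<mapsto> z + 2\<pi>\<i>h\<close> gives
  \<open>exp ((G (z + \<tau>) - G (z - \<tau>)) / \<tau>) = 1 + w e\<^sup>z + e\<^sup>2\<^sup>z\<close> for \<open>\<tau> = \<pi>\<i>h\<close>, and the reflection \<open>\<phi>\<^sup>h z - \<phi>\<^sup>h (-z) = z\<close> gives
  \<open>G z + G (-z) = 2 G 0 + z\<^sup>2/2\<close>. Entry by entry, the relations then become identities of rational
  functions of \<open>e\<^sup>z\<close>. Both equations for \<open>\<phi>\<^sup>h\<close> are residue computations, once its contour has been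
  pushed to a horizontal line above the origin; on that line the integral also visibly
  decays as \<open>z \<rightarrow> -\<infinity>\<close>, which fixes the integration constant.
\<close>

section \<open>Integrals along horizontal lines\<close>

text \<open>The half exponents in \<open>Xm\<close> set the scale: \<open>A/2\<close> and
  \<open>B/2\<close> have commutators \<open>- \<tau>\<close> and \<open>\<tau>\<close> with
  \<open>Z\<close>, so each dressing factor is a difference quotient of \<open>G\<close> with step
  \<open>\<tau>\<close>. The difference equation has step \<open>2 * \<tau>\<close> and therefore
  only controls a product of two factors, one from each end of the matrix product. With the same
  variable at both ends this is enough. With \<open>A\<close> on the left and \<open>B\<close> on
  the right, the reflection is needed to compare factors at \<open>z\<close> and \<open>- z\<close>;
  completing the square, \<open>((z + \<tau>)^2 - z^2) / (2 * \<tau>) = z + \<tau> / 2\<close>,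
  leaves \<open>exp (\<tau> / 2)\<close>, which is the ordering constant \<open>qhalf\<close>. The
  order of the orbifold point enters through \<open>1 + w * exp z + exp z ^ 2 = (1 + exp (z + \<i> *
  \<phi>)) * (1 + exp (z - \<i> * \<phi>))\<close>. The averaged dilogarithm is available for
  \<open>\<bar>Im z\<bar> < pi * (1 + h) - \<phi>\<close>; this strip contains \<open>\<tau>\<close>
  because \<open>\<phi> < pi\<close>, but for large \<open>h\<close> not \<open>2 * \<tau>\<close>,
  so shifts must not be accumulated.\<close>

lemma integrable_exp_minus_abs:
  fixes a :: real
  assumes "a > 0"
  shows "integrable lborel (\<lambda>x. exp (- a * \<bar>x\<bar>))"
proof -
  have 1: "set_integrable lborel {0..} (\<lambda>x. exp (- a * x))"
    using nonnegative_absolutely_integrable_1[OF integrable_on_exp_minus_to_infinity[OF assms, of 0]]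
    by (simp add: set_integrable_def integrable_completion)
  then have 2: "set_integrable lborel {..0} (\<lambda>x. exp (- a * (- x)))"
    unfolding set_integrable_def
    using lborel_integrable_real_affine[of "\<lambda>x. indicator {0..} x *\<^sub>R exp (- a * x)" "-1" 0]
    by (simp add: indicator_def)
  have "set_integrable lborel {0..} (\<lambda>x. exp (- a * \<bar>x\<bar>))"
    using 1 by (rule set_integrable_cong[THEN iffD1, rotated -1]) auto
  moreover have "set_integrable lborel {..0} (\<lambda>x. exp (- a * \<bar>x\<bar>))"
    using 2 by (rule set_integrable_cong[THEN iffD1, rotated -1]) auto
  ultimately have "set_integrable lborel ({0..} \<union> {..0}) (\<lambda>x. exp (- a * \<bar>x\<bar>))"
    by (rule set_integrable_Un) auto
  moreover have "{0..} \<union> {..0} = (UNIV :: real set)" by auto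
  ultimately show ?thesis by (simp add: set_integrable_def)
qed

lemma set_integrable_exp_bound:
  fixes g :: "real \<Rightarrow> complex"
  assumes "continuous_on S g" "S \<in> sets borel" "m > 0"
    and "\<And>x. x \<in> S \<Longrightarrow> norm (g x) \<le> M * exp (- m * \<bar>x\<bar>)"
  shows "set_integrable lborel S g"
  unfolding set_integrable_def
proof (rule Bochner_Integration.integrable_bound)
  show "integrable lborel (\<lambda>x. \<bar>M\<bar> * exp (- m * \<bar>x\<bar>))"
    using integrable_exp_minus_abs[OF \<open>m > 0\<close>] by simp
  show "(\<lambda>x. indicator S x *\<^sub>R g x) \<in> borel_measurable lborel"
    using borel_measurable_continuous_on_indicator[OF assms(2,1)]
    by (simp add: scaleR_conv_of_real)
  have "norm (g x) \<le> \<bar>M\<bar> * exp (- m * \<bar>x\<bar>)" if "x \<in> S" for x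
    using assms(4)[OF that] by (rule order_trans) (simp add: mult_right_mono)
  then show "AE x in lborel. norm (indicator S x *\<^sub>R g x) \<le> norm (\<bar>M\<bar> * exp (- m * \<bar>x\<bar>))"
    by (auto simp: indicator_def)
qed

text \<open>Contour integrals over segments become Henstock-Kurzweil integrals over bounded
  intervals, while \<open>qdilog\<close> consists of Lebesgue integrals over unbounded sets; this
  limit joins the two.\<close>

lemma integral_symmetric_interval_tendsto:
  fixes g :: "real \<Rightarrow> 'a::euclidean_space"
  assumes "integrable lborel g"
  shows "(\<lambda>n. integral {- real n..real n} g) \<longlonglongrightarrow> (LBINT x. g x)"
proof -
  have U: "(\<Union>n. {- real n..real n}) = UNIV"
  proof -
    have "x \<in> (\<Union>n. {- real n..real n})" for x
    proof -
      obtain n where "\<bar>x\<bar> \<le> real n" using real_arch_simple by blast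
      then show ?thesis by (auto intro!: exI[of _ n])
    qed
    then show ?thesis by auto
  qed
  have "(\<lambda>n. LBINT x:{- real n..real n}. g x) \<longlonglongrightarrow> (LBINT x:(\<Union>n. {- real n..real n}). g x)"
    by (rule set_integral_cont_up) (auto simp: incseq_def U set_integrable_def assms)
  moreover have "(LBINT x:{- real n..real n}. g x) = integral {- real n..real n} g" for n
    by (rule set_borel_integral_eq_integral)
       (auto simp: set_integrable_def intro!: integrable_real_mult_indicator integrable_mult_indicator assms)
  ultimately show ?thesis by (simp add: U set_lebesgue_integral_def)
qed

lemma contour_integral_linepath_horizontal:
  assumes "u < v"
  shows "contour_integral (linepath (Complex u y) (Complex v y)) f
    = integral {u..v} (\<lambda>x. f (Complex x y))"
proof -
  have "contour_integral (linepath (Complex u y) (Complex v y)) f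
      = contour_integral (linepath (of_real u) (of_real v)) (\<lambda>z. f (z + \<i> * of_real y))"
    unfolding contour_integral_integral
    by (intro integral_cong) (simp add: linepath_def complex_eq_iff algebra_simps Complex_eq scaleR_conv_of_real)
  also have "\<dots> = integral {u..v} (\<lambda>x. f (of_real x + \<i> * of_real y))"
    using contour_integral_linepath_Reals_eq[of "of_real u" "of_real v"] assms by simp
  finally show ?thesis by (simp add: Complex_eq)
qed

text \<open>The sides keep the length \<open>b - a\<close> while the integrand decays exponentially.
  \<open>N\<close> and \<open>R\<close> are separate thresholds: the first lets the sides get past a
  pole, the second is where the decay sets in.\<close>

lemma contour_integral_vertical_tendsto_0:
  fixes f :: "complex \<Rightarrow> complex" and x :: "nat \<Rightarrow> real"
  assumes "a < b" "m > 0" "filterlim (\<lambda>n. \<bar>x n\<bar>) at_top sequentially"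
    and cont: "\<And>n. n \<ge> N \<Longrightarrow> continuous_on {\<xi>. Re \<xi> = x n \<and> a \<le> Im \<xi> \<and> Im \<xi> \<le> b} f"
    and bound: "\<And>\<xi>. R \<le> \<bar>Re \<xi>\<bar> \<Longrightarrow> a \<le> Im \<xi> \<Longrightarrow> Im \<xi> \<le> b \<Longrightarrow> norm (f \<xi>) \<le> M * exp (- m * \<bar>Re \<xi>\<bar>)"
  shows "(\<lambda>n. contour_integral (linepath (Complex (x n) a) (Complex (x n) b)) f) \<longlonglongrightarrow> 0"
proof (rule Lim_null_comparison)
  have seg: "closed_segment (Complex u a) (Complex u b) = {\<xi>. Re \<xi> = u \<and> a \<le> Im \<xi> \<and> Im \<xi> \<le> b}" for u
    using \<open>a < b\<close> by (auto simp: closed_segment_same_Re closed_segment_eq_real_ivl)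
  have "eventually (\<lambda>n. \<bar>x n\<bar> \<ge> R) sequentially"
    using assms(3) by (auto simp: filterlim_at_top)
  with eventually_ge_at_top[of N]
  show "\<forall>\<^sub>F n in sequentially. norm (contour_integral (linepath (Complex (x n) a) (Complex (x n) b)) f)
      \<le> \<bar>M\<bar> * exp (- m * \<bar>x n\<bar>) * (b - a)"
  proof eventually_elim
    case (elim n)
    have "norm (contour_integral (linepath (Complex (x n) a) (Complex (x n) b)) f)
      \<le> \<bar>M\<bar> * exp (- m * \<bar>x n\<bar>) * norm (Complex (x n) b - Complex (x n) a)"
    proof (rule contour_integral_bound_linepath)
      show "f contour_integrable_on linepath (Complex (x n) a) (Complex (x n) b)"
        using cont[OF elim(1)] by (intro contour_integrable_continuous_linepath) (simp add: seg)
      fix \<xi> assume "\<xi> \<in> closed_segment (Complex (x n) a) (Complex (x n) b)"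
      then have "Re \<xi> = x n" "a \<le> Im \<xi>" "Im \<xi> \<le> b" by (auto simp: seg)
      then have "norm (f \<xi>) \<le> M * exp (- m * \<bar>x n\<bar>)" using bound[of \<xi>] elim(2) by simp
      also have "\<dots> \<le> \<bar>M\<bar> * exp (- m * \<bar>x n\<bar>)" by (simp add: mult_right_mono)
      finally show "norm (f \<xi>) \<le> \<bar>M\<bar> * exp (- m * \<bar>x n\<bar>)" .
    qed auto
    also have "norm (Complex (x n) b - Complex (x n) a) = b - a"
      using \<open>a < b\<close> by (simp add: cmod_def)
    finally show ?case .
  qed
  have "filterlim (\<lambda>n. - m * \<bar>x n\<bar>) at_bot sequentially"
    using filterlim_tendsto_pos_mult_at_top[OF tendsto_const \<open>m > 0\<close> assms(3)]
    by (simp add: filterlim_uminus_at_bot)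
  then have "(\<lambda>n. exp (- m * \<bar>x n\<bar>)) \<longlonglongrightarrow> 0"
    by (rule filterlim_compose[OF exp_at_bot])
  from tendsto_mult[OF tendsto_mult[OF tendsto_const this] tendsto_const]
  show "(\<lambda>n. \<bar>M\<bar> * exp (- m * \<bar>x n\<bar>) * (b - a)) \<longlonglongrightarrow> 0"
    by simp
qed

text \<open>Residue theorem on rectangles whose vertical sides at \<open>- n\<close> and
  \<open>n\<close> disappear in the limit. A counterclockwise rectangle runs backwards along its
  upper side, hence lower line minus upper line.\<close>

lemma line_integral_diff_eq_residue:
  fixes f :: "complex \<Rightarrow> complex"
  assumes "open U" "convex U" "f holomorphic_on U - {p}" "a < Im p" "Im p < b"
    and U: "\<And>\<xi>. a \<le> Im \<xi> \<Longrightarrow> Im \<xi> \<le> b \<Longrightarrow> \<xi> \<in> U"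
    and "m > 0"
    and bound: "\<And>\<xi>. R \<le> \<bar>Re \<xi>\<bar> \<Longrightarrow> a \<le> Im \<xi> \<Longrightarrow> Im \<xi> \<le> b \<Longrightarrow> norm (f \<xi>) \<le> M * exp (- m * \<bar>Re \<xi>\<bar>)"
    and int: "integrable lborel (\<lambda>x. f (Complex x a))" "integrable lborel (\<lambda>x. f (Complex x b))"
  shows "(LBINT x. f (Complex x a)) - (LBINT x. f (Complex x b)) = 2 * of_real pi * \<i> * residue f p"
proof -
  have "a < b" using assms by simp
  have cont: "continuous_on (U - {p}) f"
    using assms(3) holomorphic_on_imp_continuous_on by blast
  define r where "r n = real n" for n
  have ci: "f contour_integrable_on linepath \<zeta> \<eta>" if "closed_segment \<zeta> \<eta> \<subseteq> U - {p}" for \<zeta> \<eta>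
    using that cont by (intro contour_integrable_continuous_linepath) (rule continuous_on_subset)
  have seg1: "closed_segment (Complex s y) (Complex t y) \<subseteq> U - {p}"
    if "y = a \<or> y = b" for s t y
    using that assms(4,5) \<open>a < b\<close> by (auto simp: closed_segment_same_Im intro!: U)
  have seg2: "closed_segment (Complex s t) (Complex s t') \<subseteq> U - {p}"
    if "\<bar>s\<bar> > \<bar>Re p\<bar>" "a \<le> t" "t \<le> b" "a \<le> t'" "t' \<le> b" for s t t'
    using that assms(4,5) by (auto simp: closed_segment_same_Re closed_segment_eq_real_ivl split: if_splits intro!: U)
  have ev: "eventually (\<lambda>n. integral {- real n..real n} (\<lambda>x. f (Complex x a))
      + contour_integral (linepath (Complex (r n) a) (Complex (r n) b)) f
      - integral {- real n..real n} (\<lambda>x. f (Complex x b))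
      - contour_integral (linepath (Complex (- r n) a) (Complex (- r n) b)) f
      = 2 * of_real pi * \<i> * residue f p) sequentially"
    using eventually_gt_at_top[of "nat \<lceil>\<bar>Re p\<bar>\<rceil>"]
  proof eventually_elim
    case (elim n)
    then have n: "real n > \<bar>Re p\<bar>" by linarith
    then have "real n > 0" by linarith
    let ?A = "Complex (- r n) a" and ?B = "Complex (r n) a"
    let ?C = "Complex (r n) b" and ?D = "Complex (- r n) b"
    let ?g = "rectpath ?A ?C"
    have image: "path_image ?g \<subseteq> U - {p}"
      using n \<open>a < b\<close> assms(4,5) by (subst path_image_rectpath) (auto simp: r_def intro!: U)
    have "contour_integral ?g f = 2 * pi * \<i> * (\<Sum>q\<in>{p}. winding_number ?g q * residue f q)"
    proof (rule Residue_theorem)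
      show "\<forall>z. z \<notin> U \<longrightarrow> winding_number ?g z = 0"
      proof (intro allI impI winding_number_zero_outside)
        show "convex U" by fact
        show "path_image ?g \<subseteq> U" using image by blast
      qed auto
    qed (use assms image in \<open>auto simp: convex_connected\<close>)
    moreover have "winding_number ?g p = 1"
      using n assms(4,5) by (intro winding_number_rectpath) (auto simp: in_box_complex_iff r_def)
    ultimately have "contour_integral ?g f = 2 * of_real pi * \<i> * residue f p" by simp
    moreover have "contour_integral ?g f = contour_integral (linepath ?A ?B) f
        + (contour_integral (linepath ?B ?C) f
        + (contour_integral (linepath ?C ?D) f + contour_integral (linepath ?D ?A) f))"
      using n \<open>a < b\<close> unfolding rectpath_def Let_def
      by (simp add: ci seg1 seg2 r_def contour_integrable_joinI)
    moreover have "contour_integral (linepath ?A ?B) f = integral {- real n..real n} (\<lambda>x. f (Complex x a))"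
      using \<open>real n > 0\<close> by (subst contour_integral_linepath_horizontal) (auto simp: r_def)
    moreover have "contour_integral (linepath ?C ?D) f = - integral {- real n..real n} (\<lambda>x. f (Complex x b))"
      using contour_integral_reversepath[of "linepath ?D ?C" f] \<open>real n > 0\<close>
      by (simp add: r_def contour_integral_linepath_horizontal)
    moreover have "contour_integral (linepath ?D ?A) f = - contour_integral (linepath ?A ?D) f"
      using contour_integral_reversepath[of "linepath ?A ?D" f] by simp
    ultimately show ?case by (simp add: algebra_simps)
  qed
  have r: "filterlim (\<lambda>n. \<bar>r n\<bar>) at_top sequentially" "filterlim (\<lambda>n. \<bar>- r n\<bar>) at_top sequentially"
    by (simp_all add: r_def filterlim_real_sequentially)
  have vc: "continuous_on {\<xi>. Re \<xi> = s \<and> a \<le> Im \<xi> \<and> Im \<xi> \<le> b} f" if "\<bar>s\<bar> > \<bar>Re p\<bar>" for s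
    using that by (intro continuous_on_subset[OF cont]) (auto intro!: U)
  \<comment> \<open>The successor keeps the inequality strict when \<open>\<bar>Re p\<bar>\<close>
    is an integer.\<close>
  have N: "\<bar>r n\<bar> > \<bar>Re p\<bar>" if "n \<ge> Suc (nat \<lceil>\<bar>Re p\<bar>\<rceil>)" for n
    using that unfolding r_def by linarith
  have "(\<lambda>n. integral {- real n..real n} (\<lambda>x. f (Complex x a))
      + contour_integral (linepath (Complex (r n) a) (Complex (r n) b)) f
      - integral {- real n..real n} (\<lambda>x. f (Complex x b))
      - contour_integral (linepath (Complex (- r n) a) (Complex (- r n) b)) f)
      \<longlonglongrightarrow> (LBINT x. f (Complex x a)) + 0 - (LBINT x. f (Complex x b)) - 0"
    by (intro tendsto_intros integral_symmetric_interval_tendsto int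
         contour_integral_vertical_tendsto_0[where R=R and m=m and M=M and N="Suc (nat \<lceil>\<bar>Re p\<bar>\<rceil>)"] r)
       (use \<open>a < b\<close> \<open>m > 0\<close> N in \<open>auto intro!: bound[simplified] vc\<close>)
  moreover have "(\<lambda>n. integral {- real n..real n} (\<lambda>x. f (Complex x a))
      + contour_integral (linepath (Complex (r n) a) (Complex (r n) b)) f
      - integral {- real n..real n} (\<lambda>x. f (Complex x b))
      - contour_integral (linepath (Complex (- r n) a) (Complex (- r n) b)) f)
      \<longlonglongrightarrow> 2 * of_real pi * \<i> * residue f p"
    using ev by (rule tendsto_eventually)
  ultimately show ?thesis using LIMSEQ_unique by fastforce
qed

section \<open>The quantum dilogarithm\<close>

lemma sinh_Complex: "sinh (Complex u v) = Complex (sinh u * cos v) (cosh u * sin v)"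
  by (simp add: complex_eq_iff sinh_field_def cosh_field_def Re_exp Im_exp left_diff_distrib distrib_right diff_divide_distrib add_divide_distrib)

text \<open>The first bound rests on \<open>|sinh (u + \<i> * v)|^2 = sinh^2 u + sin^2 v\<close>,
  the second on the imaginary part alone. The first is good away from the imaginary axis, the second
  on whole horizontal lines that avoid the zeros.\<close>

lemma norm_sinh_ge: 
  "\<bar>sinh (Re \<xi>)\<bar> \<le> norm (sinh \<xi>)" "\<bar>sin (Im \<xi>)\<bar> * cosh (Re \<xi>) \<le> norm (sinh \<xi>)"
proof -
  obtain u v where \<xi>: "\<xi> = Complex u v" by (cases \<xi>)
  have "(norm (sinh \<xi>))\<^sup>2 = (sinh u)\<^sup>2 * (cos v)\<^sup>2 + (cosh u)\<^sup>2 * (sin v)\<^sup>2"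
    by (simp add: \<xi> sinh_Complex cmod_power2 power_mult_distrib)
  also have "\<dots> = (sinh u)\<^sup>2 + (sin v)\<^sup>2"
    by (simp add: cosh_square_eq cos_squared_eq algebra_simps)
  finally have "\<bar>sinh u\<bar>\<^sup>2 \<le> (norm (sinh \<xi>))\<^sup>2" by simp
  then have "\<bar>sinh u\<bar> \<le> norm (sinh \<xi>)" by (rule power2_le_imp_le) simp
  then show "\<bar>sinh (Re \<xi>)\<bar> \<le> norm (sinh \<xi>)" by (simp add: \<xi>)
  show "\<bar>sin (Im \<xi>)\<bar> * cosh (Re \<xi>) \<le> norm (sinh \<xi>)"
    using abs_Im_le_cmod[of "sinh \<xi>"] by (simp add: \<xi> sinh_Complex abs_mult mult.commute)
qed

text \<open>\<open>sinh u = (1 - exp (- 2 * u)) / 2 * exp u\<close>, where the first factor grows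
  with \<open>u\<close>; the constant is its value at \<open>s * \<epsilon>\<close>.\<close>

lemma norm_sinh_ge_exp_off_axis:
  fixes s \<epsilon> :: real
  assumes "s > 0" "\<epsilon> \<le> \<bar>Re \<xi>\<bar>"
  shows "(1 - exp (- 2 * s * \<epsilon>)) / 2 * exp (s * \<bar>Re \<xi>\<bar>) \<le> norm (sinh (of_real s * \<xi>))"
proof -
  let ?u = "s * \<bar>Re \<xi>\<bar>"
  have "exp (- 2 * ?u) \<le> exp (- 2 * s * \<epsilon>)" using assms by simp
  then have "(1 - exp (- 2 * s * \<epsilon>)) / 2 * exp ?u \<le> (1 - exp (- 2 * ?u)) / 2 * exp ?u"
    by (intro mult_right_mono divide_right_mono) auto
  also have "\<dots> = sinh ?u"
    by (simp add: sinh_field_def field_simps flip: exp_add)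
  also have "\<dots> \<le> \<bar>sinh (Re (of_real s * \<xi>))\<bar>"
    using assms by (simp flip: sinh_real_abs add: abs_mult)
  also have "\<dots> \<le> norm (sinh (of_real s * \<xi>))" by (rule norm_sinh_ge)
  finally show ?thesis .
qed

text \<open>From \<open>cosh u \<ge> exp \<bar>u\<bar> / 2\<close>. The constant is positive exactly
  when the line misses the zeros of \<open>sinh (s * \<xi>)\<close>.\<close>

lemma norm_sinh_ge_exp_on_line:
  fixes s :: real
  assumes "s > 0"
  shows "\<bar>sin (s * Im \<xi>)\<bar> / 2 * exp (s * \<bar>Re \<xi>\<bar>) \<le> norm (sinh (of_real s * \<xi>))"
proof -
  let ?u = "s * Re \<xi>"
  have "exp (s * \<bar>Re \<xi>\<bar>) / 2 \<le> cosh ?u"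
    using assms by (auto simp: cosh_field_def abs_if)
  then have "\<bar>sin (s * Im \<xi>)\<bar> * (exp (s * \<bar>Re \<xi>\<bar>) / 2) \<le> \<bar>sin (s * Im \<xi>)\<bar> * cosh ?u"
    by (rule mult_left_mono) simp
  also have "\<dots> \<le> norm (sinh (of_real s * \<xi>))"
    using norm_sinh_ge(2)[of "of_real s * \<xi>"] by simp
  finally show ?thesis by simp
qed

lemma sinh_scaled_nonzero:
  fixes s :: real
  assumes "s > 0" "Re \<xi> \<noteq> 0 \<or> 0 < s * \<bar>Im \<xi>\<bar> \<and> s * \<bar>Im \<xi>\<bar> < pi"
  shows "sinh (of_real s * \<xi>) \<noteq> 0"
proof (cases "Re \<xi> = 0")
  case False
  then have "\<bar>sinh (Re (of_real s * \<xi>))\<bar> > 0" using assms(1) by simp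
  also have "\<dots> \<le> norm (sinh (of_real s * \<xi>))" by (rule norm_sinh_ge)
  finally show ?thesis unfolding zero_less_norm_iff .
next
  case True
  then have "sin (s * \<bar>Im \<xi>\<bar>) > 0" using assms by (intro sin_gt_zero) auto
  then have "sin (s * Im \<xi>) \<noteq> 0" by (cases "Im \<xi> \<ge> 0") simp_all
  then have "0 < \<bar>sin (Im (of_real s * \<xi>))\<bar> * cosh (Re (of_real s * \<xi>))"
    by (intro mult_pos_pos) simp_all
  also have "\<dots> \<le> norm (sinh (of_real s * \<xi>))" by (rule norm_sinh_ge)
  finally show ?thesis unfolding zero_less_norm_iff .
qed

lemma norm_exp_minus_i_times: "norm (exp (- \<i> * \<xi> * z)) = exp (Re \<xi> * Im z + Im \<xi> * Re z)"
  by (simp add: norm_exp_eq_Re)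

lemma norm_exp_minus_i_times_le:
  "norm (exp (- \<i> * \<xi> * z)) \<le> exp (Im \<xi> * Re z) * exp (\<bar>Im z\<bar> * \<bar>Re \<xi>\<bar>)"
proof -
  have "Re \<xi> * Im z \<le> \<bar>Im z\<bar> * \<bar>Re \<xi>\<bar>"
    by (metis abs_ge_self abs_mult mult.commute)
  then show ?thesis unfolding norm_exp_minus_i_times by (simp flip: exp_add)
qed

text \<open>
  The radius of the half-circle in the contour of \<open>qdilog\<close>; the same number serves below as the
  height of the horizontal line to which that contour is pushed.
\<close>

definition dilog_radius :: "real \<Rightarrow> real" where
  "dilog_radius h = min 1 (1 / h) / 2"

lemma dilog_radius:
  assumes "h > 0"
  shows "dilog_radius h > 0" "dilog_radius h < 1"
    "\<bar>t\<bar> < 2 * dilog_radius h \<Longrightarrow> pi * \<bar>t\<bar> < pi" "\<bar>t\<bar> < 2 * dilog_radius h \<Longrightarrow> pi * h * \<bar>t\<bar> < pi"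
proof -
  have *: "2 * dilog_radius h \<le> 1" "h * (2 * dilog_radius h) \<le> 1" "dilog_radius h > 0"
    using assms by (auto simp: dilog_radius_def min_def field_simps)
  then show "dilog_radius h > 0" "dilog_radius h < 1" by linarith+
  assume t: "\<bar>t\<bar> < 2 * dilog_radius h"
  then show "pi * \<bar>t\<bar> < pi" using * by simp
  have "h * \<bar>t\<bar> < h * (2 * dilog_radius h)" using t assms by (intro mult_strict_left_mono)
  then have "pi * (h * \<bar>t\<bar>) < pi * 1" using * by (intro mult_strict_left_mono) auto
  then show "pi * h * \<bar>t\<bar> < pi" by (simp add: mult.assoc)
qed

lemma qdilog_kernel_denominator_nonzero:
  assumes "h > 0" "\<xi> \<noteq> 0" "\<bar>Im \<xi>\<bar> < 2 * dilog_radius h"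
  shows "sinh (of_real pi * \<xi>) \<noteq> 0" "sinh (of_real pi * of_real h * \<xi>) \<noteq> 0"
proof -
  have *: "Re \<xi> \<noteq> 0 \<or> 0 < \<bar>Im \<xi>\<bar>" using assms(2) by (auto simp: complex_eq_iff)
  show "sinh (of_real pi * \<xi>) \<noteq> 0"
    using * dilog_radius(3)[OF assms(1,3)] by (intro sinh_scaled_nonzero) auto
  have "sinh (of_real (pi * h) * \<xi>) \<noteq> 0"
    using * dilog_radius(4)[OF assms(1,3)] \<open>h > 0\<close> by (intro sinh_scaled_nonzero) auto
  then show "sinh (of_real pi * of_real h * \<xi>) \<noteq> 0" by simp
qed

text \<open>The growth rates \<open>pi\<close> and \<open>pi * h\<close> of the denominators add up,
  and the rate \<open>d\<close> of the numerator is lost. With \<open>d = \<bar>Im z\<bar>\<close>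
  this produces the strip \<open>\<bar>Im z\<bar> < pi * (1 + h)\<close>.\<close>

lemma norm_quotient_two_sinh_le:
  fixes c c' x e d h :: real and w \<xi> :: complex
  assumes "c > 0" "c' > 0" "c * exp (pi * x) \<le> norm (sinh (of_real pi * \<xi>))"
    "c' * exp (pi * h * x) \<le> norm (sinh (of_real pi * of_real h * \<xi>))" "norm w \<le> e * exp (d * x)"
  shows "norm (w / (sinh (of_real pi * \<xi>) * sinh (of_real pi * of_real h * \<xi>)))
    \<le> 1 / (c * c') * e * exp (- (pi * (1 + h) - d) * x)"
proof -
  have "norm (w / (sinh (of_real pi * \<xi>) * sinh (of_real pi * of_real h * \<xi>)))
    \<le> (e * exp (d * x)) / ((c * exp (pi * x)) * (c' * exp (pi * h * x)))"
    unfolding norm_divide norm_mult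
  proof (intro frac_le mult_mono)
    show "0 \<le> e * exp (d * x)" using assms(5) norm_ge_zero[of w] by linarith
  qed (use assms in auto)
  also have "\<dots> = 1 / (c * c') * e * (exp (d * x) / (exp (pi * x) * exp (pi * h * x)))"
    by simp
  also have "exp (d * x) / (exp (pi * x) * exp (pi * h * x)) = exp (- (pi * (1 + h) - d) * x)"
    by (simp add: algebra_simps flip: exp_add exp_diff)
  finally show ?thesis .
qed

text \<open>Uniform in the height \<open>Im \<xi>\<close>, as the vertical sides of rectangles
  require, at the price of staying \<open>\<epsilon>\<close> away from the imaginary axis.\<close>

lemma qdilog_kernel_bound_off_axis:
  assumes "h > 0" "\<epsilon> > 0"
  obtains C where "C > 0" "\<And>\<xi> z. \<epsilon> \<le> \<bar>Re \<xi>\<bar> \<Longrightarrow>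
    norm (qdilog_kernel h z \<xi>) \<le> C * exp (Im \<xi> * Re z) * exp (- (pi * (1 + h) - \<bar>Im z\<bar>) * \<bar>Re \<xi>\<bar>)"
proof
  let ?c = "(1 - exp (- 2 * pi * \<epsilon>)) / 2" and ?c' = "(1 - exp (- 2 * (pi * h) * \<epsilon>)) / 2"
  have c: "?c > 0" "?c' > 0" using assms by auto
  then show "1 / (?c * ?c') > 0" by simp
  fix \<xi> z assume "\<epsilon> \<le> \<bar>Re \<xi>\<bar>"
  then show "norm (qdilog_kernel h z \<xi>)
      \<le> 1 / (?c * ?c') * exp (Im \<xi> * Re z) * exp (- (pi * (1 + h) - \<bar>Im z\<bar>) * \<bar>Re \<xi>\<bar>)"
    unfolding qdilog_kernel_def
    using norm_sinh_ge_exp_off_axis[of pi \<epsilon> \<xi>] norm_sinh_ge_exp_off_axis[of "pi * h" \<epsilon> \<xi>] \<open>h > 0\<close>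
    by (intro norm_quotient_two_sinh_le c norm_exp_minus_i_times_le) simp_all
qed

text \<open>Counterpart of the previous bound: one height at a time, but including
  \<open>x = 0\<close>, as an integral over a whole line requires. Since \<open>C\<close> does not
  depend on \<open>z\<close>, estimates uniform in \<open>z\<close> follow.\<close>

lemma qdilog_kernel_bound_line:
  assumes "h > 0" "0 < \<bar>y\<bar>" "\<bar>y\<bar> < 2 * dilog_radius h"
  obtains C where "C > 0" "\<And>x z.
    norm (qdilog_kernel h z (Complex x y)) \<le> C * exp (y * Re z) * exp (- (pi * (1 + h) - \<bar>Im z\<bar>) * \<bar>x\<bar>)"
proof
  let ?c = "\<bar>sin (pi * y)\<bar> / 2" and ?c' = "\<bar>sin (pi * h * y)\<bar> / 2"
  have "sin (pi * \<bar>y\<bar>) > 0" "sin (pi * h * \<bar>y\<bar>) > 0"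
    using assms dilog_radius(3,4)[OF assms(1,3)] by (auto intro!: sin_gt_zero)
  then have c: "?c > 0" "?c' > 0" by (auto simp: abs_if split: if_splits)
  then show "1 / (?c * ?c') > 0" by simp
  fix x z
  show "norm (qdilog_kernel h z (Complex x y))
      \<le> 1 / (?c * ?c') * exp (y * Re z) * exp (- (pi * (1 + h) - \<bar>Im z\<bar>) * \<bar>x\<bar>)"
    unfolding qdilog_kernel_def
  proof (intro norm_quotient_two_sinh_le c)
    show "?c * exp (pi * \<bar>x\<bar>) \<le> norm (sinh (of_real pi * Complex x y))"
      using norm_sinh_ge_exp_on_line[of pi "Complex x y"] by simp
    show "?c' * exp (pi * h * \<bar>x\<bar>) \<le> norm (sinh (of_real pi * of_real h * Complex x y))"
      using norm_sinh_ge_exp_on_line[of "pi * h" "Complex x y"] \<open>h > 0\<close> by simp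
    show "norm (exp (- \<i> * Complex x y * z)) \<le> exp (y * Re z) * exp (\<bar>Im z\<bar> * \<bar>x\<bar>)"
      using norm_exp_minus_i_times_le[of "Complex x y" z] by simp
  qed
qed

lemma continuous_on_qdilog_kernel:
  assumes "h > 0" "\<And>\<xi>. \<xi> \<in> S \<Longrightarrow> \<xi> \<noteq> 0 \<and> \<bar>Im \<xi>\<bar> < 2 * dilog_radius h"
  shows "continuous_on S (qdilog_kernel h z)"
  unfolding qdilog_kernel_def
  by (intro continuous_intros) (use assms qdilog_kernel_denominator_nonzero in auto)

lemma holomorphic_on_qdilog_kernel:
  assumes "h > 0" "\<And>\<xi>. \<xi> \<in> S \<Longrightarrow> \<xi> \<noteq> 0 \<and> \<bar>Im \<xi>\<bar> < 2 * dilog_radius h"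
  shows "qdilog_kernel h z holomorphic_on S"
  unfolding qdilog_kernel_def sinh_field_def
  by (intro holomorphic_intros) (use assms qdilog_kernel_denominator_nonzero[unfolded sinh_field_def] in auto)

lemma continuous_on_Complex_line: "continuous_on A (\<lambda>x. Complex x y)"
  unfolding Complex_eq by (intro continuous_intros)

lemma integrable_qdilog_kernel_line:
  assumes "h > 0" "0 < \<bar>y\<bar>" "\<bar>y\<bar> < 2 * dilog_radius h" "\<bar>Im z\<bar> < pi * (1 + h)"
  shows "integrable lborel (\<lambda>x. qdilog_kernel h z (Complex x y))"
proof -
  obtain C where C: "C > 0" "\<And>x z.
    norm (qdilog_kernel h z (Complex x y)) \<le> C * exp (y * Re z) * exp (- (pi * (1 + h) - \<bar>Im z\<bar>) * \<bar>x\<bar>)"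
    using qdilog_kernel_bound_line assms by blast
  have "set_integrable lborel UNIV (\<lambda>x. qdilog_kernel h z (Complex x y))"
  proof (rule set_integrable_exp_bound[OF _ _ _ C(2)])
    show "continuous_on UNIV (\<lambda>x. qdilog_kernel h z (Complex x y))"
      by (rule continuous_on_compose2[OF continuous_on_qdilog_kernel[where S="{\<xi>. Im \<xi> = y}"] continuous_on_Complex_line])
         (use assms in \<open>auto simp: complex_eq_iff\<close>)
    show "pi * (1 + h) - \<bar>Im z\<bar> > 0" using assms by simp
  qed simp
  then show ?thesis by (simp add: set_integrable_def)
qed

text \<open>
  The kernel is holomorphic in a strip cut along the negative imaginary axis. This domain is
  starlike and contains the contour of \<open>qdilog\<close>, so a primitive turns the passage from the
  indented contour to a horizontal line into bookkeeping of end points.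
\<close>

lemma starlike_slit_strip:
  assumes "\<delta> > 0"
  shows "starlike {\<xi>. \<bar>Im \<xi>\<bar> < 2 * \<delta> \<and> (Re \<xi> = 0 \<longrightarrow> Im \<xi> > 0)}" (is "starlike ?S")
  unfolding starlike_def
proof (intro bexI ballI subsetI)
  show "Complex 0 \<delta> \<in> ?S" using assms by simp
  fix \<xi> \<zeta> assume \<xi>: "\<xi> \<in> ?S" and "\<zeta> \<in> closed_segment (Complex 0 \<delta>) \<xi>"
  then obtain u where u: "0 \<le> u" "u \<le> 1" "\<zeta> = (1 - u) *\<^sub>R Complex 0 \<delta> + u *\<^sub>R \<xi>"
    by (auto simp: in_segment)
  have im: "\<bar>Im \<zeta>\<bar> < 2 * \<delta>"
  proof -
    have "\<delta> \<in> {- (2 * \<delta>)<..<2 * \<delta>}" "Im \<xi> \<in> {- (2 * \<delta>)<..<2 * \<delta>}"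
      using \<xi> assms by (auto simp: abs_less_iff)
    then have "Im \<zeta> \<in> {- (2 * \<delta>)<..<2 * \<delta>}"
      using convexD_alt[OF convex_real_interval(8), of \<delta> "- (2 * \<delta>)" "2 * \<delta>" "Im \<xi>" u] u by simp
    then show ?thesis by auto
  qed
  \<comment> \<open>A segment from the centre meets the imaginary axis only at its start, unless it
    runs inside the axis; then both ends have positive imaginary part.\<close>
  have "Im \<zeta> > 0" if "Re \<zeta> = 0"
  proof (cases "u = 0")
    case False
    then have "Re \<xi> = 0" using that u by simp
    then have "Im \<xi> > 0" using \<xi> by simp
    then have "u * Im \<xi> > 0" using u False by simp
    moreover have "(1 - u) * \<delta> \<ge> 0" using u assms by simp
    ultimately show ?thesis using u by simp
  qed (use u assms in simp)
  then show "\<zeta> \<in> ?S" using im by simp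
qed

lemma open_slit_strip: "open {\<xi>. \<bar>Im \<xi>\<bar> < 2 * \<delta> \<and> (Re \<xi> = 0 \<longrightarrow> Im \<xi> > 0)}"
proof -
  have "{\<xi>. \<bar>Im \<xi>\<bar> < 2 * \<delta> \<and> (Re \<xi> = 0 \<longrightarrow> Im \<xi> > 0)}
      = {\<xi>. \<bar>Im \<xi>\<bar> < 2 * \<delta>} \<inter> - ({\<xi>. Re \<xi> = 0} \<inter> {\<xi>. Im \<xi> \<le> 0})"
    by auto
  moreover have "open {\<xi>. \<bar>Im \<xi>\<bar> < 2 * \<delta>}"
    by (intro open_Collect_less continuous_intros)
  moreover have "closed ({\<xi>. Re \<xi> = 0} \<inter> {\<xi>. Im \<xi> \<le> 0})"
    by (intro closed_Int closed_Collect_eq closed_Collect_le continuous_intros)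
  ultimately show ?thesis by (simp only: open_Int open_Compl)
qed

lemma set_integrable_qdilog_kernel_tail:
  assumes "h > 0" "\<bar>Im z\<bar> < pi * (1 + h)" "\<epsilon> > 0" "A \<in> sets borel" "\<And>x. x \<in> A \<Longrightarrow> \<bar>x\<bar> \<ge> \<epsilon>"
  shows "set_integrable lborel A (\<lambda>x. qdilog_kernel h z (of_real x))"
proof -
  obtain C where C: "\<And>\<xi> z. \<epsilon> \<le> \<bar>Re \<xi>\<bar> \<Longrightarrow>
    norm (qdilog_kernel h z \<xi>) \<le> C * exp (Im \<xi> * Re z) * exp (- (pi * (1 + h) - \<bar>Im z\<bar>) * \<bar>Re \<xi>\<bar>)"
    by (rule qdilog_kernel_bound_off_axis[OF assms(1,3)]) blast
  have "continuous_on (complex_of_real ` A) (qdilog_kernel h z)"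
  proof (rule continuous_on_qdilog_kernel[OF \<open>h > 0\<close>])
    fix \<xi> assume "\<xi> \<in> complex_of_real ` A"
    then obtain x where "x \<in> A" "\<xi> = of_real x" by blast
    then show "\<xi> \<noteq> 0 \<and> \<bar>Im \<xi>\<bar> < 2 * dilog_radius h"
      using assms(5)[OF \<open>x \<in> A\<close>] \<open>\<epsilon> > 0\<close> dilog_radius(1)[OF \<open>h > 0\<close>] by simp
  qed
  then have "continuous_on A (\<lambda>x. qdilog_kernel h z (of_real x))"
    by (rule continuous_on_compose2) (auto intro: continuous_intros)
  moreover have "norm (qdilog_kernel h z (of_real x)) \<le> C * exp (- (pi * (1 + h) - \<bar>Im z\<bar>) * \<bar>x\<bar>)"
    if "x \<in> A" for x
    using C[of "of_real x" z] assms(5)[OF that] by simp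
  ultimately show ?thesis
    using assms by (intro set_integrable_exp_bound[where m="pi * (1 + h) - \<bar>Im z\<bar>" and M=C]) simp_all
qed

lemma qdilog_eq_line_integral:
  assumes "h > 0" "\<bar>Im z\<bar> < pi * (1 + h)"
  shows "qdilog h z = - (of_real pi * of_real h / 2) *
    (LBINT x. qdilog_kernel h z (Complex x (dilog_radius h)))"
proof -
  define \<delta> where "\<delta> = dilog_radius h"
  have \<delta>: "\<delta> > 0" "\<delta> < 1" using dilog_radius[OF \<open>h > 0\<close>] by (auto simp: \<delta>_def)
  let ?k = "qdilog_kernel h z"
  let ?arc = "contour_integral (part_circlepath 0 \<delta> pi 0) ?k"
  define S where "S = {\<xi>. \<bar>Im \<xi>\<bar> < 2 * \<delta> \<and> (Re \<xi> = 0 \<longrightarrow> Im \<xi> > 0)}"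
  have hol: "?k holomorphic_on S"
    using \<open>h > 0\<close> by (intro holomorphic_on_qdilog_kernel) (auto simp: S_def \<delta>_def)
  have cont: "continuous_on S ?k" using hol by (rule holomorphic_on_imp_continuous_on)
  have "open S" "starlike S" unfolding S_def using open_slit_strip starlike_slit_strip \<delta> by auto
  then obtain F where F: "\<And>\<xi>. \<xi> \<in> S \<Longrightarrow> (F has_field_derivative ?k \<xi>) (at \<xi>)"
    using holomorphic_starlike_primitive[OF cont, of "{}"] hol
    by (auto dest: holomorphic_on_imp_differentiable_at)
  have ci: "contour_integral g ?k = F (pathfinish g) - F (pathstart g)"
    if "valid_path g" "path_image g \<subseteq> S" for g
    using contour_integral_primitive[OF DERIV_subset[OF F] that] contour_integral_unique by auto
  have horiz: "integral {u..v} (\<lambda>x. ?k (Complex x y)) = F (Complex v y) - F (Complex u y)"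
    if "u < v" "0 \<le> y" "y < 2 * \<delta>" "0 < y \<or> v < 0 \<or> 0 < u" for u v y
  proof -
    have "closed_segment (Complex u y) (Complex v y) \<subseteq> S"
      using that by (auto simp: closed_segment_same_Im closed_segment_eq_real_ivl S_def)
    then show ?thesis using that by (simp add: ci flip: contour_integral_linepath_horizontal)
  qed
  have vert: "contour_integral (linepath (Complex u 0) (Complex u \<delta>)) ?k = F (Complex u \<delta>) - F (Complex u 0)"
    if "u \<noteq> 0" for u
  proof -
    have "closed_segment (Complex u 0) (Complex u \<delta>) \<subseteq> S"
      using that \<delta> by (auto simp: closed_segment_same_Re closed_segment_eq_real_ivl S_def)
    then show ?thesis by (simp add: ci)
  qed
  have arc: "?arc = F (Complex \<delta> 0) - F (Complex (- \<delta>) 0)"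
  proof -
    have "\<delta> * cos t = 0 \<longrightarrow> sin t > 0" "\<bar>\<delta> * sin t\<bar> < 2 * \<delta>" if "0 \<le> t" "t \<le> pi" for t
    proof -
      have "sin t \<ge> 0" using that by (rule sin_ge_zero)
      moreover have "cos t = 0 \<Longrightarrow> sin t \<noteq> 0" using sin_cos_squared_add[of t] by auto
      ultimately show "\<delta> * cos t = 0 \<longrightarrow> sin t > 0" using \<delta> by auto
      have "\<delta> * \<bar>sin t\<bar> \<le> \<delta> * 1" using \<delta> by (intro mult_left_mono) auto
      then show "\<bar>\<delta> * sin t\<bar> < 2 * \<delta>" using \<delta> unfolding abs_mult by linarith
    qed
    then have "path_image (part_circlepath 0 \<delta> pi 0) \<subseteq> S"
      using \<delta> by (auto simp: path_image_part_circlepath' closed_segment_eq_real_ivl S_def)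
    then have "?arc = F (of_real \<delta>) - F (- of_real \<delta>)"
      by (simp add: ci mult.commute[of \<i>])
    then show ?thesis by (simp add: complex_of_real_def complex_minus)
  qed
  have left: "(\<lambda>n. integral {- real n..-\<delta>} (\<lambda>x. ?k (of_real x))) \<longlonglongrightarrow> (LBINT x:{..-\<delta>}. ?k (of_real x))"
  proof -
    have int: "set_integrable lborel {..-\<delta>} (\<lambda>x. ?k (of_real x))"
      using assms \<delta> by (intro set_integrable_qdilog_kernel_tail[where \<epsilon>=\<delta>]) auto
    have "(\<lambda>n. LBINT x:{- real n..-\<delta>}. ?k (of_real x)) \<longlonglongrightarrow> (LBINT x:{..-\<delta>}. ?k (of_real x))"
      using int by (intro filterlim_compose[OF tendsto_set_lebesgue_integral_at_bot])
        (auto simp: filterlim_real_sequentially filterlim_uminus_at_bot)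
    moreover have "(LBINT x:{- real n..-\<delta>}. ?k (of_real x)) = integral {- real n..-\<delta>} (\<lambda>x. ?k (of_real x))" for n
      by (intro set_borel_integral_eq_integral set_integrable_subset[OF int]) auto
    ultimately show ?thesis by simp
  qed
  have right: "(\<lambda>n. integral {\<delta>..real n} (\<lambda>x. ?k (of_real x))) \<longlonglongrightarrow> (LBINT x:{\<delta>..}. ?k (of_real x))"
  proof -
    have int: "set_integrable lborel {\<delta>..} (\<lambda>x. ?k (of_real x))"
      using assms \<delta> by (intro set_integrable_qdilog_kernel_tail[where \<epsilon>=\<delta>]) auto
    have "(\<lambda>n. LBINT x:{\<delta>..real n}. ?k (of_real x)) \<longlonglongrightarrow> (LBINT x:{\<delta>..}. ?k (of_real x))"
      using int by (intro filterlim_compose[OF tendsto_set_lebesgue_integral_at_top])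
        (auto simp: filterlim_real_sequentially)
    moreover have "(LBINT x:{\<delta>..real n}. ?k (of_real x)) = integral {\<delta>..real n} (\<lambda>x. ?k (of_real x))" for n
      by (intro set_borel_integral_eq_integral set_integrable_subset[OF int]) auto
    ultimately show ?thesis by simp
  qed
  have line: "(\<lambda>n. integral {- real n..real n} (\<lambda>x. ?k (Complex x \<delta>))) \<longlonglongrightarrow> (LBINT x. ?k (Complex x \<delta>))"
    using assms \<delta> by (intro integral_symmetric_interval_tendsto integrable_qdilog_kernel_line) (auto simp: \<delta>_def)
  \<comment> \<open>Only \<open>\<bar>x n\<bar>\<close> is prescribed, so the left and the right
    side are treated at once.\<close>
  have vlim: "(\<lambda>n. contour_integral (linepath (Complex (x n) 0) (Complex (x n) \<delta>)) ?k) \<longlonglongrightarrow> 0"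
    if "\<And>n. \<bar>x n\<bar> = real n" for x :: "nat \<Rightarrow> real"
  proof -
    obtain C where C: "C > 0" "\<And>\<xi> z. 1 \<le> \<bar>Re \<xi>\<bar> \<Longrightarrow>
      norm (qdilog_kernel h z \<xi>) \<le> C * exp (Im \<xi> * Re z) * exp (- (pi * (1 + h) - \<bar>Im z\<bar>) * \<bar>Re \<xi>\<bar>)"
      using qdilog_kernel_bound_off_axis[OF \<open>h > 0\<close> zero_less_one] by blast
    show ?thesis
    proof (rule contour_integral_vertical_tendsto_0[where N=1 and R=1 and M="C * exp (\<delta> * \<bar>Re z\<bar>)"])
      show "pi * (1 + h) - \<bar>Im z\<bar> > 0" using assms by simp
      show "filterlim (\<lambda>n. \<bar>x n\<bar>) at_top sequentially"
        by (simp add: that filterlim_real_sequentially)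
      show "continuous_on {\<xi>. Re \<xi> = x n \<and> 0 \<le> Im \<xi> \<and> Im \<xi> \<le> \<delta>} ?k" if "n \<ge> 1" for n
        using \<open>n \<ge> 1\<close> \<open>\<bar>x n\<bar> = real n\<close> \<delta> by (intro continuous_on_subset[OF cont]) (auto simp: S_def)
      fix \<xi> assume \<xi>: "1 \<le> \<bar>Re \<xi>\<bar>" "0 \<le> Im \<xi>" "Im \<xi> \<le> \<delta>"
      have "Im \<xi> * Re z \<le> Im \<xi> * \<bar>Re z\<bar>" using \<xi> by (intro mult_left_mono) auto
      also have "\<dots> \<le> \<delta> * \<bar>Re z\<bar>" using \<xi> by (intro mult_right_mono) auto
      finally have "C * exp (Im \<xi> * Re z) \<le> C * exp (\<delta> * \<bar>Re z\<bar>)" using C(1) by simp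
      then show "norm (?k \<xi>) \<le> C * exp (\<delta> * \<bar>Re z\<bar>) * exp (- (pi * (1 + h) - \<bar>Im z\<bar>) * \<bar>Re \<xi>\<bar>)"
        by (intro order_trans[OF C(2)[OF \<xi>(1)]] mult_right_mono) auto
    qed fact
  qed
  \<comment> \<open>Both sides telescope to \<open>F (Complex n 0) - F (Complex (- n) 0)\<close>:
    one along the indented contour, the other up, along the line and down again.
    \<open>n > 1\<close> suffices for nondegenerate tails because
    \<open>\<delta> < 1\<close>.\<close>
  have ev: "eventually (\<lambda>n. integral {- real n..-\<delta>} (\<lambda>x. ?k (of_real x)) + ?arc + integral {\<delta>..real n} (\<lambda>x. ?k (of_real x))
      = integral {- real n..real n} (\<lambda>x. ?k (Complex x \<delta>))
        - contour_integral (linepath (Complex (real n) 0) (Complex (real n) \<delta>)) ?k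
        + contour_integral (linepath (Complex (- real n) 0) (Complex (- real n) \<delta>)) ?k) sequentially"
    using eventually_gt_at_top[of 1]
  proof eventually_elim
    case (elim n)
    have "integral {- real n..-\<delta>} (\<lambda>x. ?k (of_real x)) = F (Complex (- \<delta>) 0) - F (Complex (- real n) 0)"
      "integral {\<delta>..real n} (\<lambda>x. ?k (of_real x)) = F (Complex (real n) 0) - F (Complex \<delta> 0)"
      using horiz[of "- real n" "- \<delta>" 0] horiz[of \<delta> "real n" 0] elim \<delta>
      unfolding complex_of_real_def by simp_all
    moreover have "integral {- real n..real n} (\<lambda>x. ?k (Complex x \<delta>))
        = F (Complex (real n) \<delta>) - F (Complex (- real n) \<delta>)"
      using elim \<delta> by (intro horiz) auto
    ultimately show ?case using arc vert[of "real n"] vert[of "- real n"] elim by simp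
  qed
  have lim1: "(\<lambda>n. integral {- real n..real n} (\<lambda>x. ?k (Complex x \<delta>))
        - contour_integral (linepath (Complex (real n) 0) (Complex (real n) \<delta>)) ?k
        + contour_integral (linepath (Complex (- real n) 0) (Complex (- real n) \<delta>)) ?k)
      \<longlonglongrightarrow> (LBINT x. ?k (Complex x \<delta>)) - 0 + 0"
    by (intro tendsto_intros line vlim) simp_all
  have lim2: "(\<lambda>n. integral {- real n..-\<delta>} (\<lambda>x. ?k (of_real x)) + ?arc + integral {\<delta>..real n} (\<lambda>x. ?k (of_real x)))
      \<longlonglongrightarrow> (LBINT x:{..-\<delta>}. ?k (of_real x)) + ?arc + (LBINT x:{\<delta>..}. ?k (of_real x))"
    by (intro tendsto_intros left right)
  have "(LBINT x:{..-\<delta>}. ?k (of_real x)) + ?arc + (LBINT x:{\<delta>..}. ?k (of_real x))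
      = (LBINT x. ?k (Complex x \<delta>)) - 0 + 0"
    by (rule LIMSEQ_unique[OF lim2 tendsto_cong[OF ev, THEN iffD2, OF lim1]])
  then show ?thesis by (simp add: qdilog_def \<delta>_def dilog_radius_def Let_def)
qed

section \<open>Growth and holomorphy of the quantum dilogarithm\<close>

text \<open>At height \<open>\<delta>\<close> the exponential in the kernel has modulus
  \<open>exp (\<delta> * Re z)\<close> times a factor depending only on \<open>Im z\<close> and the
  integration variable. A positive height thus turns into decay for \<open>Re z\<close> towards
  minus infinity.\<close>

lemma norm_qdilog_le:
  assumes "h > 0" "r < pi * (1 + h)"
  obtains C where "\<And>z. \<bar>Im z\<bar> \<le> r \<Longrightarrow> norm (qdilog h z) \<le> C * exp (dilog_radius h * Re z)"
proof -
  define \<delta> where "\<delta> = dilog_radius h"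
  have \<delta>: "\<delta> > 0" using dilog_radius(1)[OF \<open>h > 0\<close>] by (simp add: \<delta>_def)
  obtain C where C: "C > 0" "\<And>x z.
    norm (qdilog_kernel h z (Complex x \<delta>)) \<le> C * exp (\<delta> * Re z) * exp (- (pi * (1 + h) - \<bar>Im z\<bar>) * \<bar>x\<bar>)"
    using qdilog_kernel_bound_line[OF \<open>h > 0\<close>, of \<delta>] \<delta> by (auto simp: \<delta>_def)
  define m where "m = pi * (1 + h) - r"
  have m: "m > 0" using assms by (simp add: m_def)
  show ?thesis
  proof (rule that[of "pi * h / 2 * C * (LBINT x. exp (- m * \<bar>x\<bar>))"])
    fix z assume z: "\<bar>Im z\<bar> \<le> r"
    have "norm (LBINT x. qdilog_kernel h z (Complex x \<delta>)) \<le> (LBINT x. C * exp (\<delta> * Re z) * exp (- m * \<bar>x\<bar>))"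
    proof (rule Bochner_Integration.integral_norm_bound_integral)
      show "integrable lborel (\<lambda>x. qdilog_kernel h z (Complex x \<delta>))"
        using \<delta> z assms by (intro integrable_qdilog_kernel_line) (auto simp: \<delta>_def)
      show "integrable lborel (\<lambda>x. C * exp (\<delta> * Re z) * exp (- m * \<bar>x\<bar>))"
        using integrable_exp_minus_abs[OF m] by simp
      fix x
      have "- (pi * (1 + h) - \<bar>Im z\<bar>) * \<bar>x\<bar> \<le> - m * \<bar>x\<bar>"
        using z by (intro mult_right_mono) (auto simp: m_def)
      then show "norm (qdilog_kernel h z (Complex x \<delta>)) \<le> C * exp (\<delta> * Re z) * exp (- m * \<bar>x\<bar>)"
        using C(1) by (intro order_trans[OF C(2)] mult_left_mono) auto
    qed
    then have "pi * h / 2 * norm (LBINT x. qdilog_kernel h z (Complex x \<delta>))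
        \<le> pi * h / 2 * (C * exp (\<delta> * Re z) * (LBINT x. exp (- m * \<bar>x\<bar>)))"
      using \<open>h > 0\<close> by (intro mult_left_mono) auto
    then show "norm (qdilog h z) \<le> pi * h / 2 * C * (LBINT x. exp (- m * \<bar>x\<bar>)) * exp (dilog_radius h * Re z)"
      using z assms by (simp add: qdilog_eq_line_integral norm_mult \<delta>_def algebra_simps)
  qed
qed

text \<open>The integrals over \<open>[- n, n]\<close> are holomorphic by differentiation under the
  integral sign, and the local majorant makes them converge uniformly on small balls.\<close>

lemma holomorphic_on_exp_transform:
  fixes c g :: "real \<Rightarrow> complex"
  assumes "open S" and cont: "continuous_on UNIV c" "continuous_on UNIV g"
    and bound: "\<And>z0. z0 \<in> S \<Longrightarrow> \<exists>r>0. \<exists>m>0. \<exists>M. cball z0 r \<subseteq> S \<and>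
      (\<forall>z\<in>cball z0 r. \<forall>x. norm (exp (c x * z) * g x) \<le> M * exp (- m * \<bar>x\<bar>))"
  shows "(\<lambda>z. LBINT x. exp (c x * z) * g x) holomorphic_on S"
proof (rule holomorphic_uniform_sequence[OF \<open>open S\<close>])
  let ?k = "\<lambda>z x. exp (c x * z) * g x"
  have contk: "continuous_on A (?k z)" for A z
    by (intro continuous_intros continuous_on_subset[OF cont(1)] continuous_on_subset[OF cont(2)]) auto
  show "(\<lambda>z. integral (cbox (- real n) (real n)) (?k z)) holomorphic_on S" for n
  proof (rule holomorphic_on_subset[OF leibniz_rule_holomorphic])
    show "((\<lambda>z. ?k z x) has_field_derivative c x * exp (c x * z) * g x) (at z within UNIV)" for z x
      by (auto intro!: derivative_eq_intros)
    show "?k z integrable_on cbox (- real n) (real n)" for z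
      by (rule integrable_continuous[OF contk])
    have c: "continuous_on (UNIV \<times> cbox (- real n) (real n)) (\<lambda>p. c (snd p))"
      "continuous_on (UNIV \<times> cbox (- real n) (real n)) (\<lambda>p. g (snd p))"
      by (auto intro!: continuous_on_compose2[OF cont(1)] continuous_on_compose2[OF cont(2)] continuous_intros)
    show "continuous_on (UNIV \<times> cbox (- real n) (real n)) (\<lambda>(z, x). c x * exp (c x * z) * g x)"
      unfolding case_prod_beta by (intro continuous_intros c)
  qed auto
  fix z0 assume "z0 \<in> S"
  then obtain r m M where r: "r > 0" "cball z0 r \<subseteq> S" "m > 0"
    and b: "\<And>z x. z \<in> cball z0 r \<Longrightarrow> norm (?k z x) \<le> M * exp (- m * \<bar>x\<bar>)"
    using bound by meson
  define w where "w x = M * exp (- m * \<bar>x\<bar>)" for x :: real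
  have wint: "integrable lborel w"
    using integrable_exp_minus_abs[OF \<open>m > 0\<close>] by (simp add: w_def[abs_def])
  have kint: "integrable lborel (?k z)" if "z \<in> cball z0 r" for z
    using set_integrable_exp_bound[OF contk[of UNIV] _ \<open>m > 0\<close> b[OF that]] by (simp add: set_integrable_def)
  \<comment> \<open>The error is at most the tail of the integral of \<open>w\<close>, which does
    not see \<open>z\<close>; this gives the uniformity.\<close>
  have le: "norm (integral (cbox (- real n) (real n)) (?k z) - (LBINT x. ?k z x))
      \<le> (LBINT x. w x) - integral {- real n..real n} w" if z: "z \<in> cball z0 r" for z n
  proof -
    let ?i = "\<lambda>x. indicat_real {- real n..real n} x"
    have si: "set_integrable lborel {- real n..real n} (?k z)" "set_integrable lborel {- real n..real n} w"
      unfolding set_integrable_def using kint[OF z] wint by (intro integrable_mult_indicator; simp)+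
    have "(LBINT x. ?k z x) - integral {- real n..real n} (?k z) = (LBINT x. ?k z x - ?i x *\<^sub>R ?k z x)"
      using kint[OF z] si(1) by (simp add: set_borel_integral_eq_integral(2)[OF si(1), symmetric]
        set_lebesgue_integral_def set_integrable_def Bochner_Integration.integral_diff)
    moreover have "(LBINT x. w x) - integral {- real n..real n} w = (LBINT x. w x - ?i x *\<^sub>R w x)"
      using wint si(2) by (simp add: set_borel_integral_eq_integral(2)[OF si(2), symmetric]
        set_lebesgue_integral_def set_integrable_def Bochner_Integration.integral_diff)
    moreover have "norm (LBINT x. ?k z x - ?i x *\<^sub>R ?k z x) \<le> (LBINT x. w x - ?i x *\<^sub>R w x)"
    proof (rule Bochner_Integration.integral_norm_bound_integral)
      show "integrable lborel (\<lambda>x. ?k z x - ?i x *\<^sub>R ?k z x)" "integrable lborel (\<lambda>x. w x - ?i x *\<^sub>R w x)"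
        using kint[OF z] wint si by (auto simp: set_integrable_def)
      show "norm (?k z x - ?i x *\<^sub>R ?k z x) \<le> w x - ?i x *\<^sub>R w x" for x
        using b[OF z, of x] by (simp add: w_def indicator_def)
    qed
    ultimately show ?thesis by (simp add: norm_minus_commute)
  qed
  have "uniform_limit (cball z0 r) (\<lambda>n z. integral (cbox (- real n) (real n)) (?k z)) (\<lambda>z. LBINT x. ?k z x) sequentially"
  proof (rule uniform_limitI)
    fix e :: real assume "e > 0"
    have "eventually (\<lambda>n. dist (integral {- real n..real n} w) (LBINT x. w x) < e) sequentially"
      using integral_symmetric_interval_tendsto[OF wint] \<open>e > 0\<close> by (rule tendstoD)
    then show "\<forall>\<^sub>F n in sequentially. \<forall>z\<in>cball z0 r.
        dist (integral (cbox (- real n) (real n)) (?k z)) (LBINT x. ?k z x) < e"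
    proof eventually_elim
      case (elim n)
      then have "(LBINT x. w x) - integral {- real n..real n} w < e" by (simp add: dist_real_def)
      then show ?case unfolding dist_norm by (intro ballI le_less_trans[OF le])
    qed
  qed
  then show "\<exists>d>0. cball z0 d \<subseteq> S \<and> uniform_limit (cball z0 d)
      (\<lambda>n z. integral (cbox (- real n) (real n)) (?k z)) (\<lambda>z. LBINT x. ?k z x) sequentially"
    using r by blast
qed

lemma open_strip: "open {z. \<bar>Im z\<bar> < r}"
  by (intro open_Collect_less continuous_intros)

lemma convex_strip: "convex {z. \<bar>Im z\<bar> < r}"
proof -
  have "{z. \<bar>Im z\<bar> < r} = {z. Im z < r} \<inter> {z. Im z > - r}" by auto
  then show ?thesis by (simp add: convex_Int convex_halfspace_Im_lt convex_halfspace_Im_gt)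
qed

lemma holomorphic_on_qdilog:
  assumes "h > 0"
  shows "qdilog h holomorphic_on {z. \<bar>Im z\<bar> < pi * (1 + h)}"
proof -
  define \<delta> where "\<delta> = dilog_radius h"
  have \<delta>: "\<delta> > 0" using dilog_radius(1)[OF \<open>h > 0\<close>] by (simp add: \<delta>_def)
  define S where "S = {z. \<bar>Im z\<bar> < pi * (1 + h)}"
  define c where "c x = - \<i> * Complex x \<delta>" for x
  define g where "g x = qdilog_kernel h 0 (Complex x \<delta>)" for x
  have k: "qdilog_kernel h z (Complex x \<delta>) = exp (c x * z) * g x" for z x
    by (simp add: qdilog_kernel_def c_def g_def)
  obtain C where C: "C > 0" "\<And>x z.
    norm (qdilog_kernel h z (Complex x \<delta>)) \<le> C * exp (\<delta> * Re z) * exp (- (pi * (1 + h) - \<bar>Im z\<bar>) * \<bar>x\<bar>)"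
    using qdilog_kernel_bound_line[OF \<open>h > 0\<close>, of \<delta>] \<delta> by (auto simp: \<delta>_def)
  have "(\<lambda>z. LBINT x. exp (c x * z) * g x) holomorphic_on S"
  proof (rule holomorphic_on_exp_transform)
    show "open S" unfolding S_def by (rule open_strip)
    show "continuous_on UNIV c" unfolding c_def by (intro continuous_intros continuous_on_Complex_line)
    show "continuous_on UNIV g" unfolding g_def
      using \<delta> \<open>h > 0\<close>
      by (intro continuous_on_compose2[OF continuous_on_qdilog_kernel[where S="{\<xi>. Im \<xi> = \<delta>}"] continuous_on_Complex_line])
         (auto simp: complex_eq_iff \<delta>_def)
    fix z0 assume "z0 \<in> S"
    \<comment> \<open>Half the distance from \<open>z0\<close> to the boundary of the strip: on the
      ball the decay rate \<open>pi * (1 + h) - \<bar>Im z\<bar>\<close> is still at least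
      \<open>r\<close>.\<close>
    define r where "r = (pi * (1 + h) - \<bar>Im z0\<bar>) / 2"
    have r: "r > 0" "\<bar>Im z0\<bar> + r = pi * (1 + h) - r" using \<open>z0 \<in> S\<close> by (auto simp: r_def S_def field_simps)
    have im: "\<bar>Im z\<bar> \<le> \<bar>Im z0\<bar> + r" and re: "Re z \<le> Re z0 + r" if "z \<in> cball z0 r" for z
      using that abs_Im_le_cmod[of "z0 - z"] abs_Re_le_cmod[of "z0 - z"] by (auto simp: dist_norm)
    have "cball z0 r \<subseteq> S"
    proof
      fix z assume "z \<in> cball z0 r"
      from im[OF this] show "z \<in> S" using r unfolding S_def by auto
    qed
    moreover have "norm (exp (c x * z) * g x) \<le> C * exp (\<delta> * (Re z0 + r)) * exp (- r * \<bar>x\<bar>)"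
      if z: "z \<in> cball z0 r" for z x
    proof -
      have "- (pi * (1 + h) - \<bar>Im z\<bar>) * \<bar>x\<bar> \<le> - r * \<bar>x\<bar>"
        using im[OF z] r by (intro mult_right_mono) auto
      moreover have "\<delta> * Re z \<le> \<delta> * (Re z0 + r)" using re[OF z] \<delta> by (intro mult_left_mono) auto
      ultimately show ?thesis
        using C(1) unfolding k[symmetric] by (intro order_trans[OF C(2)] mult_mono) auto
    qed
    ultimately show "\<exists>r>0. \<exists>m>0. \<exists>M. cball z0 r \<subseteq> S \<and>
      (\<forall>z\<in>cball z0 r. \<forall>x. norm (exp (c x * z) * g x) \<le> M * exp (- m * \<bar>x\<bar>))"
      using r(1) by blast
  qed
  then have "(\<lambda>z. - (of_real pi * of_real h / 2) * (LBINT x. qdilog_kernel h z (Complex x \<delta>))) holomorphic_on S"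
    unfolding k by (intro holomorphic_intros)
  then show ?thesis
    unfolding S_def \<delta>_def
    by (rule holomorphic_transform) (simp add: qdilog_eq_line_integral[OF \<open>h > 0\<close>])
qed

section \<open>Reflection and difference equation by residues\<close>

text \<open>Reciprocal of the difference quotient of \<open>sinh\<close> at a simple zero. It
  delivers the residues at \<open>0\<close>, with \<open>e = 1\<close>, and at \<open>\<i>\<close>,
  with \<open>e = - 1\<close>.\<close>

lemma tendsto_sinh_scaled_quotient:
  fixes s :: real and p :: complex
  assumes "sinh (of_real s * p) = 0" "s \<noteq> 0" "cosh (of_real s * p) = e" "e \<noteq> 0"
  shows "((\<lambda>w. (w - p) / sinh (of_real s * w)) \<longlongrightarrow> 1 / (of_real s * e)) (at p)"
proof -
  have "((\<lambda>w. sinh (of_real s * w)) has_field_derivative of_real s * e) (at p)"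
    using assms(3) by (auto intro!: derivative_eq_intros)
  then have "((\<lambda>w. sinh (of_real s * w) / (w - p)) \<longlongrightarrow> of_real s * e) (at p)"
    using assms(1) by (simp add: has_field_derivative_iff)
  from tendsto_inverse[OF this] show ?thesis
    using assms by (simp add: field_simps)
qed

text \<open>The difference is a line integral of the odd function
  \<open>f \<xi> = k \<xi> - k' \<xi>\<close>. By oddness the lines at heights
  \<open>\<delta>\<close> and \<open>- \<delta>\<close> carry opposite integrals, so the residue at
  \<open>0\<close> determines twice the wanted one.\<close>

lemma qdilog_reflection:
  assumes "h > 0" "\<bar>Im z\<bar> < pi * (1 + h)"
  shows "qdilog h z - qdilog h (- z) = z"
proof -
  define \<delta> where "\<delta> = dilog_radius h"
  have \<delta>: "\<delta> > 0" using dilog_radius(1)[OF \<open>h > 0\<close>] by (simp add: \<delta>_def)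
  define k where "k = qdilog_kernel h z"
  define k' where "k' = qdilog_kernel h (- z)"
  define f where "f \<xi> = k \<xi> - k' \<xi>" for \<xi>
  define U where "U = {\<xi>. \<bar>Im \<xi>\<bar> < 2 * \<delta>}"
  define m where "m = pi * (1 + h) - \<bar>Im z\<bar>"
  have int: "integrable lborel (\<lambda>x. k (Complex x y))" "integrable lborel (\<lambda>x. k' (Complex x y))" 
    if "y = \<delta> \<or> y = - \<delta>" for y
    using that assms \<delta> unfolding k_def k'_def by (auto intro!: integrable_qdilog_kernel_line simp: \<delta>_def)
  have fint: "integrable lborel (\<lambda>x. f (Complex x y))" if "y = \<delta> \<or> y = - \<delta>" for y
    unfolding f_def using int[OF that] by simp
  have hol: "f holomorphic_on U - {0}"
    unfolding f_def k_def k'_def using \<open>h > 0\<close>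
    by (intro holomorphic_intros holomorphic_on_qdilog_kernel) (auto simp: U_def \<delta>_def)
  \<comment> \<open>The kernel has a triple pole at \<open>0\<close>, but its odd part \<open>f\<close> only a simple one.\<close>
  have "residue f 0 = - 2 * \<i> * z / (of_real pi * (of_real pi * of_real h))"
  proof (rule residue_simple'[OF _ _ hol])
    show "open U" unfolding U_def by (rule open_strip)
    show "0 \<in> U" using \<delta> by (simp add: U_def)
    have "((\<lambda>w. exp (- \<i> * w * z) - exp (- \<i> * w * - z)) has_field_derivative (- 2 * \<i> * z)) (at 0)"
      by (auto intro!: derivative_eq_intros)
    then have "((\<lambda>w. (exp (- \<i> * w * z) - exp (- \<i> * w * - z)) / w) \<longlongrightarrow> - 2 * \<i> * z) (at 0)"
      by (simp add: has_field_derivative_iff)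
    moreover have "((\<lambda>w. w / sinh (of_real pi * w)) \<longlongrightarrow> 1 / of_real pi) (at (0::complex))"
      using tendsto_sinh_scaled_quotient[of pi 0 1] by simp
    moreover have "((\<lambda>w. w / sinh (of_real pi * of_real h * w)) \<longlongrightarrow> 1 / (of_real pi * of_real h)) (at (0::complex))"
      using tendsto_sinh_scaled_quotient[of "pi * h" 0 1] \<open>h > 0\<close> by simp
    ultimately have "((\<lambda>w. (exp (- \<i> * w * z) - exp (- \<i> * w * - z)) / w *
        (w / sinh (of_real pi * w)) * (w / sinh (of_real pi * of_real h * w)))
        \<longlongrightarrow> - 2 * \<i> * z * (1 / of_real pi) * (1 / (of_real pi * of_real h))) (at 0)"
      by (intro tendsto_mult)
    also have "?this \<longleftrightarrow> ((\<lambda>w. f w * (w - 0)) \<longlongrightarrow> - 2 * \<i> * z * (1 / of_real pi) * (1 / (of_real pi * of_real h))) (at 0)"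
      by (intro tendsto_cong eventually_at_filter[THEN iffD2] always_eventually)
         (simp add: f_def k_def k'_def qdilog_kernel_def diff_divide_distrib left_diff_distrib)
    finally show "((\<lambda>w. f w * (w - 0)) \<longlongrightarrow> - 2 * \<i> * z / (of_real pi * (of_real pi * of_real h))) (at 0)"
      by simp
  qed
  moreover have "(LBINT x. f (Complex x (- \<delta>))) - (LBINT x. f (Complex x \<delta>)) = 2 * of_real pi * \<i> * residue f 0"
  proof -
    obtain C where C: "C > 0" "\<And>\<xi> z. 1 \<le> \<bar>Re \<xi>\<bar> \<Longrightarrow>
      norm (qdilog_kernel h z \<xi>) \<le> C * exp (Im \<xi> * Re z) * exp (- (pi * (1 + h) - \<bar>Im z\<bar>) * \<bar>Re \<xi>\<bar>)"
      using qdilog_kernel_bound_off_axis[OF \<open>h > 0\<close> zero_less_one] by blast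
    show ?thesis
    proof (rule line_integral_diff_eq_residue[where U=U and m=m and R=1 and M="2 * (C * exp (\<delta> * \<bar>Re z\<bar>))"])
      fix \<xi> assume \<xi>: "1 \<le> \<bar>Re \<xi>\<bar>" "- \<delta> \<le> Im \<xi>" "Im \<xi> \<le> \<delta>"
      have le: "norm (qdilog_kernel h w \<xi>) \<le> C * exp (\<delta> * \<bar>Re z\<bar>) * exp (- m * \<bar>Re \<xi>\<bar>)"
        if w: "w = z \<or> w = - z" for w
      proof -
        have "Im \<xi> * Re w \<le> \<bar>Im \<xi> * Re w\<bar>" by simp
        also have "\<dots> \<le> \<delta> * \<bar>Re z\<bar>" unfolding abs_mult using \<xi> w by (intro mult_mono) auto
        finally have "C * exp (Im \<xi> * Re w) \<le> C * exp (\<delta> * \<bar>Re z\<bar>)" using C(1) by simp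
        moreover have "pi * (1 + h) - \<bar>Im w\<bar> = m" using w by (auto simp: m_def)
        ultimately show ?thesis
          using C(2)[OF \<xi>(1), of w] by (smt (verit, best) exp_ge_zero mult_right_mono)
      qed
      show "norm (f \<xi>) \<le> 2 * (C * exp (\<delta> * \<bar>Re z\<bar>)) * exp (- m * \<bar>Re \<xi>\<bar>)"
        using norm_triangle_ineq4[of "k \<xi>" "k' \<xi>"] le[of z] le[of "- z"] by (simp add: f_def k_def k'_def)
    qed (use assms hol \<delta> fint in \<open>auto simp: U_def m_def open_strip convex_strip\<close>)
  qed
  moreover have "(LBINT x. f (Complex x (- \<delta>))) = - (LBINT x. f (Complex x \<delta>))"
  proof -
    have "(LBINT x. f (Complex x (- \<delta>))) = (LBINT x. f (Complex (- x) (- \<delta>)))"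
      using lborel_integral_real_affine[of "-1" "\<lambda>x. f (Complex x (- \<delta>))" 0] by simp
    moreover have "f (Complex (- x) (- \<delta>)) = - f (Complex x \<delta>)" for x
      by (simp add: f_def k_def k'_def qdilog_kernel_def flip: complex_minus)
    ultimately show ?thesis by simp
  qed
  ultimately have "- 2 * (LBINT x. f (Complex x \<delta>))
      = 2 * of_real pi * \<i> * (- 2 * \<i> * z / (of_real pi * (of_real pi * of_real h)))"
    by simp
  also have "\<dots> = 4 * z / (of_real pi * of_real h)" by (simp add: field_simps)
  finally have "- 2 * (LBINT x. f (Complex x \<delta>)) = 4 * z / (of_real pi * of_real h)" .
  from arg_cong[OF this, of "\<lambda>t. - t / 2"]
  have I: "(LBINT x. f (Complex x \<delta>)) = - 2 * z / (of_real pi * of_real h)" by simp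
  have "qdilog h z - qdilog h (- z) = - (of_real pi * of_real h / 2) * (LBINT x. f (Complex x \<delta>))"
    using assms int[of \<delta>] by (simp add: qdilog_eq_line_integral f_def k_def k'_def \<delta>_def right_diff_distrib)
  then show ?thesis using \<open>h > 0\<close> by (simp add: I)
qed

lemma one_plus_exp_minus_nonzero:
  assumes "\<bar>Im z\<bar> < pi"
  shows "exp (- z) + 1 \<noteq> 0"
proof
  assume "exp (- z) + 1 = 0"
  then have e: "exp (- z) = - 1" by (rule eq_neg_iff_add_eq_0[THEN iffD2])
  have "exp (- Re z) = norm (exp (- z))" by simp
  also have "\<dots> = 1" unfolding e by simp
  finally have "Re z = 0" by simp
  then have "cos (Im z) = -1" using e by (simp add: complex_eq_iff Re_exp)
  then have "cos \<bar>Im z\<bar> = cos pi" by simp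
  then show False using assms cos_inj_pi[of "\<bar>Im z\<bar>" pi] by simp
qed

text \<open>The shifts of \<open>z\<close> multiply the kernel by
  \<open>exp (pi * h * \<xi>)\<close> and its inverse, so the difference cancels
  \<open>sinh (pi * h * \<xi>)\<close> and leaves \<open>2 * f\<close>. Raising the line by
  \<open>\<i>\<close> multiplies \<open>f\<close> by \<open>- exp z\<close>; hence the residue at
  \<open>\<i>\<close> gives a linear equation for the integral, with coefficient
  \<open>1 + exp z\<close>.\<close>

lemma qdilog_difference_equation:
  assumes "h > 0" "\<bar>Im z\<bar> < pi"
  shows "qdilog h (z + \<i> * of_real pi * of_real h) - qdilog h (z - \<i> * of_real pi * of_real h)
    = 2 * of_real pi * \<i> * of_real h / (exp (- z) + 1)"
proof -
  define \<delta> where "\<delta> = dilog_radius h"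
  have \<delta>: "\<delta> > 0" "\<delta> < 1" using dilog_radius[OF \<open>h > 0\<close>] by (auto simp: \<delta>_def)
  define z1 where "z1 = z + \<i> * of_real pi * of_real h"
  define z2 where "z2 = z - \<i> * of_real pi * of_real h"
  have im: "\<bar>Im z1\<bar> < pi * (1 + h)" "\<bar>Im z2\<bar> < pi * (1 + h)"
  proof -
    have "Im z1 = Im z + pi * h" "Im z2 = Im z - pi * h" by (simp_all add: z1_def z2_def)
    moreover have "pi * h > 0" using \<open>h > 0\<close> by simp
    ultimately show "\<bar>Im z1\<bar> < pi * (1 + h)" "\<bar>Im z2\<bar> < pi * (1 + h)"
      using assms(2) unfolding distrib_left by linarith+
  qed
  define f where "f \<xi> = exp (- \<i> * \<xi> * z) / sinh (of_real pi * \<xi>)" for \<xi>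
  \<comment> \<open>The strip \<open>0 < Im \<xi> < 2\<close>, centred at the only zero of
    \<open>sinh (pi * \<xi>)\<close> that it contains.\<close>
  define U where "U = {\<xi>. \<bar>Im (\<xi> - \<i>)\<bar> < 1}"
  have U: "\<xi> \<in> U \<longleftrightarrow> 0 < Im \<xi> \<and> Im \<xi> < 2" for \<xi> by (auto simp: U_def)
  have shift: "f (Complex x (1 + \<delta>)) = - exp z * f (Complex x \<delta>)" for x
  proof -
    have 1: "Complex x (1 + \<delta>) = Complex x \<delta> + \<i>" by (simp add: complex_eq_iff)
    have "of_real pi * (Complex x \<delta> + \<i>) = of_real pi * Complex x \<delta> + \<i> * of_real pi"
      by (simp add: algebra_simps)
    then have "sinh (of_real pi * (Complex x \<delta> + \<i>)) = - sinh (of_real pi * Complex x \<delta>)"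
      by (simp add: sinh_field_def exp_add exp_diff exp_minus divide_simps)
    moreover have "exp (- \<i> * (Complex x \<delta> + \<i>) * z) = exp z * exp (- \<i> * Complex x \<delta> * z)"
      by (simp add: algebra_simps flip: exp_add)
    ultimately show ?thesis by (simp only: f_def 1) simp
  qed
  have ker: "qdilog_kernel h z1 (Complex x \<delta>) - qdilog_kernel h z2 (Complex x \<delta>) = 2 * f (Complex x \<delta>)" for x
  proof -
    let ?\<xi> = "Complex x \<delta>"
    have nz: "sinh (of_real pi * of_real h * ?\<xi>) \<noteq> 0"
      using qdilog_kernel_denominator_nonzero(2)[OF \<open>h > 0\<close>, of ?\<xi>] \<delta> by (auto simp: \<delta>_def complex_eq_iff)
    have "exp (- \<i> * ?\<xi> * z1) - exp (- \<i> * ?\<xi> * z2)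
        = exp (- \<i> * ?\<xi> * z) * (exp (of_real pi * of_real h * ?\<xi>) - exp (- (of_real pi * of_real h * ?\<xi>)))"
      by (simp add: z1_def z2_def algebra_simps flip: exp_add)
    also have "\<dots> = exp (- \<i> * ?\<xi> * z) * (2 * sinh (of_real pi * of_real h * ?\<xi>))"
      by (simp add: sinh_field_def)
    finally have e: "exp (- \<i> * ?\<xi> * z1) - exp (- \<i> * ?\<xi> * z2)
        = exp (- \<i> * ?\<xi> * z) * (2 * sinh (of_real pi * of_real h * ?\<xi>))" .
    show ?thesis unfolding qdilog_kernel_def f_def diff_divide_distrib[symmetric] e using nz by simp
  qed
  have int: "integrable lborel (\<lambda>x. qdilog_kernel h z1 (Complex x \<delta>))"
    "integrable lborel (\<lambda>x. qdilog_kernel h z2 (Complex x \<delta>))"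
    using assms \<delta> im by (auto intro!: integrable_qdilog_kernel_line simp: \<delta>_def)
  have fint: "integrable lborel (\<lambda>x. f (Complex x \<delta>))"
    using integrable_mult_right[OF Bochner_Integration.integrable_diff[OF int], of "1 / 2"] unfolding ker by simp
  have sinh_i: "sinh (of_real pi * \<i>) = 0" "cosh (of_real pi * \<i>) = -1"
    by (simp_all add: sinh_field_def cosh_field_def mult.commute[of _ \<i>] exp_minus)
  have hol: "f holomorphic_on U - {\<i>}"
  proof -
    have "sinh (of_real pi * \<xi>) \<noteq> 0" if "\<xi> \<in> U - {\<i>}" for \<xi>
    proof -
      have eq: "of_real pi * \<xi> = of_real pi * (\<xi> - \<i>) + \<i> * of_real pi" by (simp add: algebra_simps)
      have "Re (\<xi> - \<i>) \<noteq> 0 \<or> 0 < pi * \<bar>Im (\<xi> - \<i>)\<bar> \<and> pi * \<bar>Im (\<xi> - \<i>)\<bar> < pi"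
        using that by (auto simp: U_def complex_eq_iff)
      then have "sinh (of_real pi * (\<xi> - \<i>)) \<noteq> 0" by (intro sinh_scaled_nonzero) auto
      then show ?thesis unfolding eq by (simp add: sinh_field_def exp_add exp_diff exp_minus divide_simps)
    qed
    then show ?thesis unfolding f_def sinh_field_def by (intro holomorphic_intros) auto
  qed
  have "open U" "convex U"
  proof -
    have "U = (+) \<i> ` {z. \<bar>Im z\<bar> < 1}" by (force simp: U_def image_iff algebra_simps intro: exI[of _ "_ - \<i>"])
    then show "open U" "convex U" using open_strip convex_strip by (auto intro: open_translation convex_translation)
  qed
  have "residue f \<i> = - exp z / of_real pi"
  proof (rule residue_simple'[OF \<open>open U\<close> _ hol])
    show "\<i> \<in> U" by (simp add: U_def)
    have "((\<lambda>w. exp (- \<i> * w * z) * ((w - \<i>) / sinh (of_real pi * w))) \<longlongrightarrow> exp (- \<i> * \<i> * z) * (1 / (of_real pi * (-1)))) (at \<i>)"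
      using sinh_i by (intro tendsto_mult tendsto_sinh_scaled_quotient tendsto_intros) auto
    then show "((\<lambda>w. f w * (w - \<i>)) \<longlongrightarrow> - exp z / of_real pi) (at \<i>)"
      by (simp add: f_def)
  qed
  moreover have "(LBINT x. f (Complex x \<delta>)) - (LBINT x. f (Complex x (1 + \<delta>))) = 2 * of_real pi * \<i> * residue f \<i>"
  proof -
    let ?c = "(1 - exp (- 2 * pi * 1)) / 2"
    have c: "?c > 0" by simp
    show ?thesis
    proof (rule line_integral_diff_eq_residue[where U=U and m="pi - \<bar>Im z\<bar>" and R=1 and M="exp (2 * \<bar>Re z\<bar>) / ?c"])
      fix \<xi> assume \<xi>: "1 \<le> \<bar>Re \<xi>\<bar>" "\<delta> \<le> Im \<xi>" "Im \<xi> \<le> 1 + \<delta>"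
      have "Im \<xi> * Re z \<le> \<bar>Im \<xi> * Re z\<bar>" by simp
      also have "\<dots> \<le> 2 * \<bar>Re z\<bar>" unfolding abs_mult using \<xi> \<delta> by (intro mult_mono) auto
      finally have "norm (exp (- \<i> * \<xi> * z)) \<le> exp (2 * \<bar>Re z\<bar>) * exp (\<bar>Im z\<bar> * \<bar>Re \<xi>\<bar>)"
        by (intro order_trans[OF norm_exp_minus_i_times_le] mult_right_mono) auto
      moreover have "?c * exp (pi * \<bar>Re \<xi>\<bar>) \<le> norm (sinh (of_real pi * \<xi>))"
        using norm_sinh_ge_exp_off_axis[of pi 1 \<xi>] \<xi> by simp
      ultimately have "norm (f \<xi>) \<le> (exp (2 * \<bar>Re z\<bar>) * exp (\<bar>Im z\<bar> * \<bar>Re \<xi>\<bar>)) / (?c * exp (pi * \<bar>Re \<xi>\<bar>))"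
        unfolding f_def norm_divide using c by (intro frac_le mult_pos_pos) simp_all
      also have "\<dots> = exp (2 * \<bar>Re z\<bar>) / ?c * (exp (\<bar>Im z\<bar> * \<bar>Re \<xi>\<bar>) / exp (pi * \<bar>Re \<xi>\<bar>))"
        by (simp only: times_divide_times_eq)
      also have "exp (\<bar>Im z\<bar> * \<bar>Re \<xi>\<bar>) / exp (pi * \<bar>Re \<xi>\<bar>) = exp (- (pi - \<bar>Im z\<bar>) * \<bar>Re \<xi>\<bar>)"
        by (simp add: algebra_simps flip: exp_diff)
      finally show "norm (f \<xi>) \<le> exp (2 * \<bar>Re z\<bar>) / ?c * exp (- (pi - \<bar>Im z\<bar>) * \<bar>Re \<xi>\<bar>)" .
    next
      show "integrable lborel (\<lambda>x. f (Complex x (1 + \<delta>)))"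
        unfolding shift using fint by simp
    qed (use assms hol \<delta> fint \<open>open U\<close> \<open>convex U\<close> in \<open>auto simp: U\<close>)
  qed
  moreover have "(LBINT x. f (Complex x (1 + \<delta>))) = - exp z * (LBINT x. f (Complex x \<delta>))"
    unfolding shift by simp
  ultimately have "(1 + exp z) * (LBINT x. f (Complex x \<delta>)) = - 2 * \<i> * exp z"
    by (simp add: algebra_simps)
  moreover have "1 + exp z \<noteq> 0"
    using one_plus_exp_minus_nonzero[of "- z"] assms(2) by (simp add: add.commute)
  ultimately have I: "(LBINT x. f (Complex x \<delta>)) = - 2 * \<i> * exp z / (1 + exp z)"
    by (simp add: field_simps)
  have "qdilog h z1 - qdilog h z2 = - (of_real pi * of_real h / 2) *
      (LBINT x. qdilog_kernel h z1 (Complex x \<delta>) - qdilog_kernel h z2 (Complex x \<delta>))"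
    using assms int im by (simp add: qdilog_eq_line_integral \<delta>_def right_diff_distrib)
  also have "\<dots> = - (of_real pi * of_real h) * (LBINT x. f (Complex x \<delta>))"
    unfolding ker by simp
  also have "\<dots> = 2 * of_real pi * \<i> * of_real h / (exp (- z) + 1)"
    using \<open>1 + exp z \<noteq> 0\<close> unfolding I by (simp add: exp_minus divide_simps)
  finally show ?thesis by (simp add: z1_def z2_def)
qed

section \<open>The averaged dilogarithm and its primitive\<close>

text \<open>The division by 2 matches the half exponents of \<open>Xm\<close>: \<open>At / 2\<close>
  is \<open>A / 2\<close> plus this function of \<open>Z\<close>.\<close>

definition mean_dilog :: "real \<Rightarrow> real \<Rightarrow> complex \<Rightarrow> complex" where
  "mean_dilog h \<phi> z = (qdilog h (z + \<i> * of_real \<phi>) + qdilog h (z - \<i> * of_real \<phi>)) / 2"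

lemma Im_shift_bound:
  fixes \<phi> :: real
  assumes "0 \<le> \<phi>" "\<bar>Im z\<bar> < r - \<phi>"
  shows "\<bar>Im (z + \<i> * of_real \<phi>)\<bar> < r" "\<bar>Im (z - \<i> * of_real \<phi>)\<bar> < r"
  using assms by auto

lemma holomorphic_on_mean_dilog:
  assumes "h > 0" "0 \<le> \<phi>"
  shows "mean_dilog h \<phi> holomorphic_on {z. \<bar>Im z\<bar> < pi * (1 + h) - \<phi>}"
  unfolding mean_dilog_def
  by (intro holomorphic_intros holomorphic_on_compose_gen[OF _ holomorphic_on_qdilog[OF \<open>h > 0\<close>], unfolded o_def])
     (use Im_shift_bound[OF \<open>0 \<le> \<phi>\<close>] in auto)

text \<open>Negation exchanges the two shifts, so the imaginary parts cancel when the two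
  reflections of \<open>qdilog\<close> are added.\<close>

lemma mean_dilog_reflection:
  assumes "h > 0" "0 \<le> \<phi>" "\<bar>Im z\<bar> < pi * (1 + h) - \<phi>"
  shows "mean_dilog h \<phi> z - mean_dilog h \<phi> (- z) = z"
proof -
  have "qdilog h (z + \<i> * of_real \<phi>) - qdilog h (- z - \<i> * of_real \<phi>) = z + \<i> * of_real \<phi>"
    "qdilog h (z - \<i> * of_real \<phi>) - qdilog h (- z + \<i> * of_real \<phi>) = z - \<i> * of_real \<phi>"
    using qdilog_reflection[OF \<open>h > 0\<close> Im_shift_bound(1)[OF assms(2,3)]]
      qdilog_reflection[OF \<open>h > 0\<close> Im_shift_bound(2)[OF assms(2,3)]] by (simp_all add: algebra_simps)
  from arg_cong2[OF this, of "(+)"] show ?thesis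
    by (simp add: mean_dilog_def field_simps)
qed

text \<open>With \<open>u = exp (z + \<i> * \<phi>)\<close> and
  \<open>v = exp (z - \<i> * \<phi>)\<close> the quadratic is \<open>(1 + u) * (1 + v)\<close>, and
  the quotient on the left is its logarithmic derivative
  \<open>u / (1 + u) + v / (1 + v)\<close>.\<close>

lemma mean_dilog_difference_equation:
  assumes "h > 0" "0 \<le> \<phi>" "\<bar>Im z\<bar> < pi - \<phi>" "w = exp (\<i> * of_real \<phi>) + exp (- \<i> * of_real \<phi>)"
    "\<tau> = \<i> * of_real pi * of_real h"
  shows "(mean_dilog h \<phi> (z + \<tau>) - mean_dilog h \<phi> (z - \<tau>)) / \<tau> * (1 + w * exp z + exp z ^ 2)
    = w * exp z + 2 * exp z ^ 2"
proof -
  have \<tau>: "\<tau> \<noteq> 0" using assms by simp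
  let ?u = "exp (z + \<i> * of_real \<phi>)" and ?v = "exp (z - \<i> * of_real \<phi>)"
  have e: "?u = exp z * exp (\<i> * of_real \<phi>)" "?v = exp z * exp (- \<i> * of_real \<phi>)" by (simp_all flip: exp_add)
  have ee: "exp (\<i> * of_real \<phi>) * exp (- \<i> * of_real \<phi>) = 1" by (simp flip: exp_add)
  have sum: "?u + ?v = w * exp z" by (simp only: e assms(4)) (simp only: algebra_simps)
  have prod: "?u * ?v = exp z ^ 2"
    by (simp add: power2_eq_square flip: exp_add)
  have d: "qdilog h (\<zeta> + \<tau>) - qdilog h (\<zeta> - \<tau>) = 2 * \<tau> * exp \<zeta> / (1 + exp \<zeta>)" "1 + exp \<zeta> \<noteq> 0"
    if "\<bar>Im \<zeta>\<bar> < pi" for \<zeta>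
  proof -
    have nz: "exp (- \<zeta>) + 1 \<noteq> 0" by (rule one_plus_exp_minus_nonzero[OF that])
    have "exp \<zeta> * (exp (- \<zeta>) + 1) = 1 + exp \<zeta>" by (simp add: distrib_left flip: exp_add)
    then show "1 + exp \<zeta> \<noteq> 0" using nz by auto
    then have "1 / (exp (- \<zeta>) + 1) = exp \<zeta> / (1 + exp \<zeta>)"
      using nz \<open>exp \<zeta> * (exp (- \<zeta>) + 1) = 1 + exp \<zeta>\<close> by (simp add: field_simps)
    then show "qdilog h (\<zeta> + \<tau>) - qdilog h (\<zeta> - \<tau>) = 2 * \<tau> * exp \<zeta> / (1 + exp \<zeta>)"
    proof -
      have "qdilog h (\<zeta> + \<tau>) - qdilog h (\<zeta> - \<tau>) = 2 * \<tau> * (1 / (exp (- \<zeta>) + 1))"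
        using qdilog_difference_equation[OF \<open>h > 0\<close> that] by (simp add: assms(5) mult_ac)
      also have "\<dots> = 2 * \<tau> * exp \<zeta> / (1 + exp \<zeta>)"
        unfolding \<open>1 / (exp (- \<zeta>) + 1) = exp \<zeta> / (1 + exp \<zeta>)\<close> by simp
      finally show ?thesis .
    qed
  qed
  note u = d[OF Im_shift_bound(1)[OF assms(2,3)]] and v = d[OF Im_shift_bound(2)[OF assms(2,3)]]
  have "mean_dilog h \<phi> (z + \<tau>) - mean_dilog h \<phi> (z - \<tau>)
      = ((qdilog h (z + \<i> * of_real \<phi> + \<tau>) - qdilog h (z + \<i> * of_real \<phi> - \<tau>))
        + (qdilog h (z - \<i> * of_real \<phi> + \<tau>) - qdilog h (z - \<i> * of_real \<phi> - \<tau>))) / 2"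
    by (simp add: mean_dilog_def add_divide_distrib diff_divide_distrib add.commute add.left_commute diff_add_eq diff_diff_eq algebra_simps)
  also have "\<dots> = \<tau> * (?u / (1 + ?u) + ?v / (1 + ?v))"
    unfolding u(1) v(1) by (simp add: field_simps)
  finally have "(mean_dilog h \<phi> (z + \<tau>) - mean_dilog h \<phi> (z - \<tau>)) / \<tau> = ?u / (1 + ?u) + ?v / (1 + ?v)"
    using \<tau> by simp
  moreover have "1 + w * exp z + exp z ^ 2 = (1 + ?u) * (1 + ?v)"
    unfolding prod[symmetric] sum[symmetric] by (simp add: algebra_simps)
  moreover have "(?u / (1 + ?u) + ?v / (1 + ?v)) * ((1 + ?u) * (1 + ?v)) = ?u * (1 + ?v) + ?v * (1 + ?u)"
  proof -
    have "(a / b + c / d) * (b * d) = a * d + c * b" if "b \<noteq> 0" "d \<noteq> 0" for a b c d :: complex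
      using that by (simp add: field_simps)
    from this[OF u(2) v(2)] show ?thesis .
  qed
  moreover have "\<dots> = w * exp z + 2 * exp z ^ 2"
    unfolding prod[symmetric] sum[symmetric] by (simp add: algebra_simps)
  ultimately show ?thesis by simp
qed

lemma norm_mean_dilog_le:
  assumes "h > 0" "0 \<le> \<phi>" "r < pi * (1 + h) - \<phi>"
  obtains C where "C \<ge> 0" "\<And>z. \<bar>Im z\<bar> \<le> r \<Longrightarrow> norm (mean_dilog h \<phi> z) \<le> C * exp (dilog_radius h * Re z)"
proof -
  have "r + \<phi> < pi * (1 + h)" using assms by simp
  from norm_qdilog_le[OF \<open>h > 0\<close> this]
  obtain C where C: "\<And>z. \<bar>Im z\<bar> \<le> r + \<phi> \<Longrightarrow> norm (qdilog h z) \<le> C * exp (dilog_radius h * Re z)" by blast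
  show ?thesis
  proof (rule that[of "\<bar>C\<bar>"])
    fix z assume z: "\<bar>Im z\<bar> \<le> r"
    have "norm (mean_dilog h \<phi> z) \<le> (norm (qdilog h (z + \<i> * of_real \<phi>)) + norm (qdilog h (z - \<i> * of_real \<phi>))) / 2"
      unfolding mean_dilog_def norm_divide by (simp add: norm_triangle_ineq)
    also have "\<dots> \<le> C * exp (dilog_radius h * Re z)"
    proof -
      have "\<bar>Im (z + \<i> * of_real \<phi>)\<bar> \<le> r + \<phi>" "\<bar>Im (z - \<i> * of_real \<phi>)\<bar> \<le> r + \<phi>"
        using z \<open>0 \<le> \<phi>\<close> by auto
      from C[OF this(1)] C[OF this(2)] show ?thesis by simp
    qed
    also have "\<dots> \<le> \<bar>C\<bar> * exp (dilog_radius h * Re z)" by (intro mult_right_mono) auto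
    finally show "norm (mean_dilog h \<phi> z) \<le> \<bar>C\<bar> * exp (dilog_radius h * Re z)" .
  qed simp
qed

text \<open>Both identities for \<open>G\<close> hold up to a constant, because their derivatives
  are the reflection and the difference equation of \<open>mean_dilog\<close>. The value at
  \<open>0\<close> fixes the first constant, the limit at minus infinity the second.\<close>

lemma mean_dilog_primitive:
  assumes "h > 0" "0 \<le> \<phi>" "\<phi> < pi" "w = exp (\<i> * of_real \<phi>) + exp (- \<i> * of_real \<phi>)"
    "\<tau> = \<i> * of_real pi * of_real h"
  obtains G where "\<And>z. \<bar>Im z\<bar> < pi * (1 + h) - \<phi> \<Longrightarrow> (G has_field_derivative mean_dilog h \<phi> z) (at z)"
    and "\<And>z. \<bar>Im z\<bar> < pi * (1 + h) - \<phi> \<Longrightarrow> G z + G (- z) = 2 * G 0 + z ^ 2 / 2"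
    and "\<And>z. \<bar>Im z\<bar> < pi - \<phi> \<Longrightarrow> exp ((G (z + \<tau>) - G (z - \<tau>)) / \<tau>) = 1 + w * exp z + exp z ^ 2"
proof -
  define T where "T = {z. \<bar>Im z\<bar> < pi * (1 + h) - \<phi>}"
  have T: "open T" "convex T" unfolding T_def by (rule open_strip convex_strip)+
  obtain G where "\<And>z. z \<in> T \<Longrightarrow> (G has_field_derivative mean_dilog h \<phi> z) (at z within T)"
    using holomorphic_convex_primitive'[OF T(2,1)] holomorphic_on_mean_dilog[OF assms(1,2)]
    unfolding T_def by blast
  then have G: "(G has_field_derivative mean_dilog h \<phi> z) (at z)" if "z \<in> T" for z
    using that by (simp add: at_within_open[OF _ T(1)])
  have ph: "pi * h > 0" using \<open>h > 0\<close> by simp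
  have im: "Im (z + \<tau>) = Im z + pi * h" "Im (z - \<tau>) = Im z - pi * h"
    "Re (z + \<tau>) = Re z" "Re (z - \<tau>) = Re z" for z
    by (simp_all add: assms(5))
  show ?thesis
  proof (rule that)
    show "(G has_field_derivative mean_dilog h \<phi> z) (at z)" if "\<bar>Im z\<bar> < pi * (1 + h) - \<phi>" for z
      using that G by (simp add: T_def)
    show "G z + G (- z) = 2 * G 0 + z ^ 2 / 2" if z: "\<bar>Im z\<bar> < pi * (1 + h) - \<phi>" for z
    proof -
      have "(\<lambda>z. G z + G (- z) - z ^ 2 / 2) constant_on T"
      proof (rule has_field_derivative_0_imp_constant_on[OF _ convex_connected[OF T(2)] T(1)])
        fix z assume "z \<in> T"
        then have "- z \<in> T" by (simp add: T_def)
        then have "((\<lambda>z. G (- z)) has_field_derivative mean_dilog h \<phi> (- z) * (- 1)) (at z)"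
          by (intro DERIV_chain2[where f=G and g=uminus] G) (auto intro!: derivative_eq_intros)
        then have "((\<lambda>z. G z + G (- z) - z ^ 2 / 2) has_field_derivative
            mean_dilog h \<phi> z - mean_dilog h \<phi> (- z) - z) (at z)"
          using G[OF \<open>z \<in> T\<close>] by (auto intro!: derivative_eq_intros)
        then show "((\<lambda>z. G z + G (- z) - z ^ 2 / 2) has_field_derivative 0) (at z)"
          using mean_dilog_reflection[OF assms(1,2)] \<open>z \<in> T\<close> by (simp add: T_def)
      qed
      then obtain K where "\<And>z. z \<in> T \<Longrightarrow> G z + G (- z) - z ^ 2 / 2 = K" by (auto simp: constant_on_def)
      from this[of z] this[of 0] z show ?thesis by (simp add: T_def algebra_simps)
    qed
    define U where "U = {z. \<bar>Im z\<bar> < pi - \<phi>}"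
    have U: "open U" "convex U" unfolding U_def by (rule open_strip convex_strip)+
    define L where "L z = (G (z + \<tau>) - G (z - \<tau>)) / \<tau>" for z
    \<comment> \<open>Showing that \<open>M\<close> is constant avoids the choice of a logarithm of
      the quadratic.\<close>
    define M where "M z = exp (- L z) * (1 + w * exp z + exp z ^ 2)" for z
    have sh: "z + \<tau> \<in> T" "z - \<tau> \<in> T" if "z \<in> U" for z
      using that ph unfolding T_def U_def mem_Collect_eq im distrib_left by linarith+
    have "M constant_on U"
    proof (rule has_field_derivative_0_imp_constant_on[OF _ convex_connected[OF U(2)] U(1)])
      fix z assume z: "z \<in> U"
      define L' where "L' = (mean_dilog h \<phi> (z + \<tau>) - mean_dilog h \<phi> (z - \<tau>)) / \<tau>"
      have "((\<lambda>z. G (z + \<tau>)) has_field_derivative mean_dilog h \<phi> (z + \<tau>) * 1) (at z)"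
        by (intro DERIV_chain2[where f=G and g="\<lambda>z. z + \<tau>"] G sh z) (auto intro!: derivative_eq_intros)
      moreover have "((\<lambda>z. G (z - \<tau>)) has_field_derivative mean_dilog h \<phi> (z - \<tau>) * 1) (at z)"
        by (intro DERIV_chain2[where f=G and g="\<lambda>z. z - \<tau>"] G sh z) (auto intro!: derivative_eq_intros)
      ultimately have L: "(L has_field_derivative L') (at z)"
        unfolding L_def L'_def by (intro DERIV_cdivide DERIV_diff) simp_all
      have "L' * (1 + w * exp z + exp z ^ 2) = w * exp z + 2 * exp z ^ 2"
        unfolding L'_def using z assms by (intro mean_dilog_difference_equation) (auto simp: U_def)
      then have "exp (- L z) * (- L') * (1 + w * exp z + exp z ^ 2) + exp (- L z) * (w * exp z + 2 * exp z ^ 2) = 0"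
        by (simp add: mult.assoc flip: distrib_left)
      moreover have "(M has_field_derivative
          exp (- L z) * (- L') * (1 + w * exp z + exp z ^ 2) + exp (- L z) * (w * exp z + 2 * exp z ^ 2)) (at z)"
        unfolding M_def by (auto intro!: derivative_eq_intros L simp: power2_eq_square algebra_simps)
      ultimately show "(M has_field_derivative 0) (at z)" by simp
    qed
    then obtain K where K: "\<And>z. z \<in> U \<Longrightarrow> M z = K" by (auto simp: constant_on_def)
    have real: "of_real x \<in> U" for x using assms by (simp add: U_def)
    \<comment> \<open>\<open>L x\<close> is a difference quotient of \<open>G\<close> over the
      vertical segment from \<open>x - \<tau>\<close> to \<open>x + \<tau>\<close>, on which the
      derivative of \<open>G\<close> is bounded by a multiple of \<open>exp (\<delta> * x)\<close>.
      The segment stays in the strip because \<open>\<phi> < pi\<close>.\<close>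
    have "((\<lambda>x::real. L (of_real x)) \<longlongrightarrow> 0) at_bot"
    proof -
      define \<delta> where "\<delta> = dilog_radius h"
      have \<delta>: "\<delta> > 0" using dilog_radius(1)[OF \<open>h > 0\<close>] by (simp add: \<delta>_def)
      have "pi * h < pi * (1 + h) - \<phi>" using assms(3) by (simp add: distrib_left)
      then obtain C where C: "C \<ge> 0" "\<And>z. \<bar>Im z\<bar> \<le> pi * h \<Longrightarrow> norm (mean_dilog h \<phi> z) \<le> C * exp (\<delta> * Re z)"
        unfolding \<delta>_def using norm_mean_dilog_le[OF assms(1,2)] by metis
      have bound: "norm (L (of_real x)) \<le> 2 * C * exp (\<delta> * x)" for x
      proof -
        have "norm (G (of_real x + \<tau>) - G (of_real x - \<tau>)) \<le> C * exp (\<delta> * x) * norm ((of_real x + \<tau>) - (of_real x - \<tau>))"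
        proof (rule field_differentiable_bound)
          let ?S = "closed_segment (of_real x - \<tau>) (of_real x + \<tau>)"
          fix \<zeta> assume "\<zeta> \<in> ?S"
          moreover have "Re (of_real x - \<tau>) = Re (of_real x + \<tau>)" by (simp add: assms(5))
          ultimately have "Re \<zeta> = x" "Im \<zeta> \<in> closed_segment (- (pi * h)) (pi * h)"
            by (simp_all add: closed_segment_same_Re assms(5))
          then have \<zeta>: "Re \<zeta> = x" "\<bar>Im \<zeta>\<bar> \<le> pi * h"
            using ph by (auto simp: closed_segment_eq_real_ivl)
          then have "\<zeta> \<in> T" using \<open>pi * h < pi * (1 + h) - \<phi>\<close> by (simp add: T_def)
          then show "(G has_field_derivative mean_dilog h \<phi> \<zeta>) (at \<zeta> within ?S)"
            using G DERIV_subset by blast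
          show "norm (mean_dilog h \<phi> \<zeta>) \<le> C * exp (\<delta> * x)" using C(2)[OF \<zeta>(2)] \<zeta>(1) by simp
        qed auto
        moreover have "norm ((of_real x + \<tau>) - (of_real x - \<tau>)) = 2 * norm \<tau>"
          by (simp flip: mult_2 add: norm_mult)
        moreover have "norm \<tau> > 0" using assms by simp
        ultimately show ?thesis by (simp add: L_def norm_divide field_simps)
      qed
      have "filterlim (\<lambda>x. \<delta> * x) at_bot at_bot"
        using filterlim_tendsto_pos_mult_at_bot[OF tendsto_const \<delta> filterlim_ident] by blast
      then have "((\<lambda>x. 2 * C * exp (\<delta> * x)) \<longlongrightarrow> 2 * C * 0) at_bot"
        by (intro tendsto_mult tendsto_const filterlim_compose[OF exp_at_bot])
      then have "((\<lambda>x. 2 * C * exp (\<delta> * x)) \<longlongrightarrow> 0) at_bot" by simp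
      then show ?thesis by (rule Lim_null_comparison[rotated]) (simp add: bound)
    qed
    moreover have "((\<lambda>x::real. exp (of_real x :: complex)) \<longlongrightarrow> 0) at_bot"
    proof -
      have "((\<lambda>x::real. of_real (exp x) :: complex) \<longlongrightarrow> of_real 0) at_bot"
        by (intro tendsto_of_real exp_at_bot)
      then show ?thesis by (simp add: exp_of_real)
    qed
    ultimately have "((\<lambda>x::real. M (of_real x)) \<longlongrightarrow> exp (- 0) * (1 + w * 0 + 0 ^ 2)) at_bot"
      unfolding M_def by (intro tendsto_intros)
    moreover have "(\<lambda>x::real. M (of_real x)) = (\<lambda>_. K)" using K real by auto
    ultimately have "((\<lambda>x::real. K) \<longlongrightarrow> 1) at_bot" by simp
    then have "K = 1" by (simp add: tendsto_const_iff)
    show "exp ((G (z + \<tau>) - G (z - \<tau>)) / \<tau>) = 1 + w * exp z + exp z ^ 2" if "\<bar>Im z\<bar> < pi - \<phi>" for z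
    proof -
      have "exp (- L z) * (1 + w * exp z + exp z ^ 2) = 1"
        using K[of z] that \<open>K = 1\<close> by (simp add: M_def U_def)
      then show ?thesis by (simp add: L_def exp_minus field_simps)
    qed
  qed
qed

section \<open>Matrices of functions of one operator\<close>

no_notation fps_nth (infixl \<open>$\<close> 75)

lemma mat2_nth [simp]:
  "mat2 a b c d $ 1 $ 1 = a" "mat2 a b c d $ 1 $ 2 = b" "mat2 a b c d $ 2 $ 1 = c" "mat2 a b c d $ 2 $ 2 = d"
  by (simp_all add: mat2_def)

lemma matrix_2_eq_iff: "M = N \<longleftrightarrow> M $ 1 $ 1 = N $ 1 $ 1 \<and> M $ 1 $ 2 = N $ 1 $ 2 \<and> M $ 2 $ 1 = N $ 2 $ 1 \<and> M $ 2 $ 2 = N $ 2 $ 2"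
  for M N :: "'a^2^2"
  unfolding vec_eq_iff forall_2 by blast

lemma matrix_mult_2_nth: "(M ** N) $ i $ j = M $ i $ 1 * N $ 1 $ j + M $ i $ 2 * N $ 2 $ j"
  for M N :: "('a::semiring_1)^2^2"
  by (simp add: matrix_matrix_mult_def sum_2)

definition shear_matrix :: "complex \<Rightarrow> complex^2^2" where
  "shear_matrix z = mat2 0 (- exp (z / 2)) (exp (- z / 2)) 0"

text \<open>The two exponentials cancel around a diagonal entry and double around an off-diagonal
  one, so only integral powers of \<open>exp z\<close> survive.\<close>

lemma shear_matrix_sandwich:
  "shear_matrix z ** M ** shear_matrix z = mat2 (- M$2$2) (exp z * M$2$1) (exp (- z) * M$1$2) (- M$1$1)"
proof -
  define u v where "u = exp (z / 2)" and "v = exp (- z / 2)"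
  have uv: "u * v = 1" "u * u = exp z" "v * v = exp (- z)"
    by (simp_all add: u_def v_def flip: exp_add)
  have "s * m * t = (s * t) * m" for s m t :: complex by (simp only: mult_ac)
  then have "u * m * v = m" "v * m * u = m" "u * m * u = exp z * m" "v * m * v = exp (- z) * m" for m
    using uv by (metis mult.commute mult_1)+
  then show ?thesis
    unfolding matrix_2_eq_iff matrix_mult_2_nth shear_matrix_def mat2_nth u_def[symmetric] v_def[symmetric]
    by simp
qed

definition analytic_matrix :: "(complex \<Rightarrow> complex^2^2) \<Rightarrow> bool" where
  "analytic_matrix K \<longleftrightarrow> (\<forall>i j. (\<lambda>z. K z $ i $ j) analytic_on \<real>)"

lemma analytic_matrix_const: "analytic_matrix (\<lambda>_. M)"
  by (simp add: analytic_matrix_def)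

lemma analytic_matrix_mult:
  assumes "analytic_matrix K" "analytic_matrix N"
  shows "analytic_matrix (\<lambda>z. K z ** N z)"
  using assms by (auto simp: analytic_matrix_def matrix_mult_2_nth intro!: analytic_intros)

lemma analytic_matrix_shear: "analytic_matrix shear_matrix" "analytic_matrix (\<lambda>z. shear_matrix (- z))"
  by (auto simp: analytic_matrix_def forall_2 shear_matrix_def intro!: analytic_intros)

definition fcalc_matrix ::
    "((complex \<Rightarrow> complex) \<Rightarrow> 'op \<Rightarrow> 'op) \<Rightarrow> (complex \<Rightarrow> complex^2^2) \<Rightarrow> 'op \<Rightarrow> 'op^2^2" where
  "fcalc_matrix fcalc K x = (\<chi> i j. fcalc (\<lambda>z. K z $ i $ j) x)"

lemma fcalc_matrix_nth: "fcalc_matrix fcalc K x $ i $ j = fcalc (\<lambda>z. K z $ i $ j) x"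
  by (simp add: fcalc_matrix_def)

text \<open>Antidiagonal outer factors leave one product, never a sum, in each entry; the entries
  can be compared one at a time.\<close>

lemma Xm_sandwich:
  "Xm scal fcalc W ** N ** Xm scal fcalc Y = mat2
     (- (fcalc exp (scal (1/2) * W) * N$2$2 * fcalc exp (- (scal (1/2) * Y))))
     (fcalc exp (scal (1/2) * W) * N$2$1 * fcalc exp (scal (1/2) * Y))
     (fcalc exp (- (scal (1/2) * W)) * N$1$2 * fcalc exp (- (scal (1/2) * Y)))
     (- (fcalc exp (- (scal (1/2) * W)) * N$1$1 * fcalc exp (scal (1/2) * Y)))"
  by (simp add: matrix_2_eq_iff matrix_mult_2_nth Xm_def)

context operator_calculus
begin

lemma scal_zero: "scal 0 = 0"
  using scal_add[of 0 0] by simp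

lemma scal_minus: "scal (- a) = - scal a"
  using scal_add[of a "- a"] by (simp add: scal_zero eq_neg_iff_add_eq_0 add.commute)

lemma fcalc_scale:
  assumes "x \<in> V" "f analytic_on \<real>"
  shows "fcalc (\<lambda>z. a * f z) x = scal a * fcalc f x"
  using fcalc_mult[of x "\<lambda>_. a" f] fcalc_const[of x a] assms by simp

lemma fcalc_minus:
  assumes "x \<in> V" "f analytic_on \<real>"
  shows "fcalc (\<lambda>z. - f z) x = - fcalc f x"
  using fcalc_scale[OF assms, of "-1"] by (simp add: scal_minus scal_one)

text \<open>Gives access to \<open>Z + \<i> * \<phi>\<close>, which is not self-adjoint and so lies
  outside \<open>V\<close>: its functions are reached by composition from \<open>Z\<close>, and
  \<open>r\<close> keeps the shifted axis inside the domain of \<open>f\<close>.\<close>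

lemma fcalc_real_affine:
  assumes "x \<in> V" "f analytic_on {z. \<bar>Im z\<bar> < r}" "\<bar>Im b\<bar> < r"
  shows "fcalc f (scal (of_real s) * x + scal b) = fcalc (\<lambda>z. f (of_real s * z + b)) x"
proof -
  have "fcalc (\<lambda>z. of_real s * z + b) x = fcalc (\<lambda>z. of_real s * z) x + fcalc (\<lambda>_. b) x"
    using assms(1) by (intro fcalc_add analytic_intros)
  also have "fcalc (\<lambda>z. of_real s * z) x = scal (of_real s) * x"
    using fcalc_scale[of x "\<lambda>z. z" "of_real s"] assms(1) by (simp add: fcalc_ident analytic_on_ident)
  finally have "fcalc (\<lambda>z. of_real s * z + b) x = scal (of_real s) * x + scal b"
    using assms(1) by (simp add: fcalc_const)
  moreover have "f analytic_on (\<lambda>z. of_real s * z + b) ` \<real>"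
    by (rule analytic_on_subset[OF assms(2)]) (use assms(3) in \<open>auto simp: complex_is_Real_iff\<close>)
  moreover have "(\<lambda>z. of_real s * z + b) analytic_on \<real>" by (intro analytic_intros)
  ultimately show ?thesis
    using fcalc_compose[of x "\<lambda>z. of_real s * z + b" f] assms(1) by simp
qed

lemma fcalc_exp_linear:
  assumes "x \<in> V"
  shows "fcalc exp (scal (of_real s) * x) = fcalc (\<lambda>z. exp (of_real s * z)) x"
proof -
  have "fcalc exp (scal (of_real s) * x + scal 0) = fcalc (\<lambda>z. exp (of_real s * z + 0)) x"
    by (rule fcalc_real_affine[OF assms, where r=1]) (auto intro!: analytic_intros)
  then show ?thesis by (simp add: scal_zero)
qed

text \<open>
  Keeping the two positions of the dressing factor apart avoids any continuation of the quantum
  dilogarithm beyond its strip: in a product \<open>exp w * g x * exp w\<close> the left factor is moved right and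
  the right one left, so that both factors meet at \<open>x\<close> without a further shift.
\<close>

lemma dressed_exponential:
  assumes "w \<in> V" "x \<in> V" and comm: "w * x - x * w = scal c" and c: "c \<noteq> 0" "Re c = 0" "\<bar>Im c\<bar> < r"
    and G: "\<And>z. \<bar>Im z\<bar> < r \<Longrightarrow> (G has_field_derivative f z) (at z)"
  shows "fcalc exp (w + fcalc f x) = fcalc (\<lambda>z. exp ((G (z + c) - G z) / c)) x * fcalc exp w" (is ?left)
    and "fcalc exp (w + fcalc f x) = fcalc exp w * fcalc (\<lambda>z. exp ((G z - G (z - c)) / c)) x" (is ?right)
    and "(\<lambda>z. exp ((G (z + c) - G z) / c)) analytic_on \<real>" (is ?anP)
    and "(\<lambda>z. exp ((G z - G (z - c)) / c)) analytic_on \<real>" (is ?anQ)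
proof -
  define T where "T = {z. \<bar>Im z\<bar> < r}"
  \<comment> \<open>\<open>P\<close> and \<open>Q\<close> are holomorphic where argument and shifted
    argument both lie in the strip. These sets contain the real axis since
    \<open>\<bar>Im c\<bar> < r\<close>.\<close>
  define T1 where "T1 = {z. \<bar>Im z\<bar> < r \<and> \<bar>Im (z + c)\<bar> < r}"
  define T2 where "T2 = {z. \<bar>Im z\<bar> < r \<and> \<bar>Im (z - c)\<bar> < r}"
  have T: "open T" "convex T" unfolding T_def by (rule open_strip convex_strip)+
  have open12: "open T1" "open T2"
    unfolding T1_def T2_def by (intro open_Collect_conj open_Collect_less continuous_intros)+
  have GT: "G holomorphic_on T"
    unfolding holomorphic_on_open[OF T(1)] using G by (auto simp only: T_def mem_Collect_eq)
  have "f holomorphic_on T"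
    by (rule holomorphic_transform[OF holomorphic_deriv[OF GT T(1)]]) (simp add: T_def G DERIV_imp_deriv)
  then have fan: "f analytic_on T" by (simp add: analytic_on_open T)
  define P where "P z = exp ((G (z + c) - G z) / c)" for z
  define Q where "Q z = exp ((G z - G (z - c)) / c)" for z
  have "(G \<circ> (\<lambda>z. z + c)) holomorphic_on T1" "(G \<circ> (\<lambda>z. z - c)) holomorphic_on T2"
    by (rule holomorphic_on_compose_gen[OF _ GT]; force simp: T_def T1_def T2_def intro: holomorphic_intros)+
  then have GT': "(\<lambda>z. G (z + c)) holomorphic_on T1" "(\<lambda>z. G (z - c)) holomorphic_on T2"
    by (simp_all only: o_def)
  have GT'': "G holomorphic_on T1" "G holomorphic_on T2"
    by (rule holomorphic_on_subset[OF GT]; force simp: T_def T1_def T2_def)+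
  have P: "P holomorphic_on T1" unfolding P_def by (intro holomorphic_intros GT' GT'') (use c in auto)
  have Q: "Q holomorphic_on T2" unfolding Q_def by (intro holomorphic_intros GT' GT'') (use c in auto)
  have reals: "\<real> \<subseteq> T1" "\<real> \<subseteq> T2"
    using c by (auto simp: T1_def T2_def complex_is_Real_iff)
  have Pan: "P analytic_on \<real>" by (rule analytic_on_subset[OF _ reals(1)]) (simp add: P analytic_on_open open12)
  have Qan: "Q analytic_on \<real>" by (rule analytic_on_subset[OF _ reals(2)]) (simp add: Q analytic_on_open open12)
  show ?anP using Pan unfolding P_def[abs_def] .
  show ?anQ using Qan unfolding Q_def[abs_def] .
  \<comment> \<open>The imaginary parts of \<open>z\<close> and \<open>z - c\<close> are
    \<open>t * Im c\<close> and \<open>(t - 1) * Im c\<close>. The second one is what allows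
    shifting \<open>Q\<close> by \<open>c\<close>.\<close>
  have strip: "\<bar>Im z\<bar> < r \<and> \<bar>Im (z - c)\<bar> < r" if zs: "z \<in> strip c" for z
  proof -
    obtain x t where z: "z = of_real x + of_real t * c" "0 \<le> t" "t \<le> 1" using zs unfolding strip_def by blast
    have "\<bar>t * Im c\<bar> \<le> 1 * \<bar>Im c\<bar>" unfolding abs_mult using z by (intro mult_right_mono) auto
    moreover have "\<bar>(t - 1) * Im c\<bar> \<le> 1 * \<bar>Im c\<bar>" unfolding abs_mult using z by (intro mult_right_mono) auto
    ultimately show ?thesis using z(1) c(3) by (simp add: left_diff_distrib)
  qed
  then have "strip c \<subseteq> T" "strip c \<subseteq> T2" unfolding T_def T2_def by blast+
  then have fstrip: "f analytic_on strip c" and Qstrip: "Q analytic_on strip c"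
    using analytic_on_subset[OF fan] analytic_on_subset[of Q T2 "strip c"] Q
    by (simp_all add: analytic_on_open open12)
  have int: "exp (1 / c * contour_integral (linepath z (z + c)) f) = P z" if "z \<in> T1" for z
  proof -
    have "closed_segment z (z + c) \<subseteq> T"
      using that T(2) by (intro closed_segment_subset) (auto simp: T_def T1_def)
    then have "(f has_contour_integral (G (z + c) - G z)) (linepath z (z + c))"
      using contour_integral_primitive[of T G f "linepath z (z + c)"] DERIV_subset[OF G]
      by (simp add: T_def)
    then show ?thesis by (simp add: contour_integral_unique P_def)
  qed
  have "fcalc exp (w + fcalc f x) = fcalc (\<lambda>z. exp (1 / c * contour_integral (linepath z (z + c)) f)) x * fcalc exp w"
    by (rule exp_standard_rule[OF assms(1,2) comm c(1) fstrip])
  also have "fcalc (\<lambda>z. exp (1 / c * contour_integral (linepath z (z + c)) f)) x = fcalc P x"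
  proof (rule fcalc_cong[OF \<open>x \<in> V\<close> _ Pan])
    have "(\<lambda>z. exp (1 / c * contour_integral (linepath z (z + c)) f)) holomorphic_on T1"
      by (rule holomorphic_transform[OF P]) (rule int[symmetric])
    then show "(\<lambda>z. exp (1 / c * contour_integral (linepath z (z + c)) f)) analytic_on \<real>"
      by (intro analytic_on_subset[OF _ reals(1)]) (simp add: analytic_on_open open12)
    show "exp (1 / c * contour_integral (linepath z (z + c)) f) = P z" if "z \<in> \<real>" for z
      using int that reals by blast
  qed
  finally have left: "fcalc exp (w + fcalc f x) = fcalc P x * fcalc exp w" .
  then show ?left unfolding P_def[abs_def] .
  \<comment> \<open>The second form follows from the first: moving \<open>exp w\<close> to the right
    of \<open>Q\<close> shifts the argument by \<open>c\<close>, and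
    \<open>Q (z + c) = P z\<close>.\<close>
  have "fcalc exp w * fcalc Q x = fcalc (\<lambda>z. Q (z + c)) x * fcalc exp w"
    by (rule exp_shift[OF assms(1,2) comm Qstrip])
  also have "(\<lambda>z. Q (z + c)) = P" by (simp add: P_def Q_def fun_eq_iff)
  finally show ?right unfolding left Q_def[abs_def] by simp
qed

lemma fcalc_matrix_mult:
  assumes "x \<in> V" "analytic_matrix K" "analytic_matrix N"
  shows "fcalc_matrix fcalc K x ** fcalc_matrix fcalc N x = fcalc_matrix fcalc (\<lambda>z. K z ** N z) x"
proof -
  have an: "(\<lambda>z. K z $ i $ j) analytic_on \<real>" "(\<lambda>z. N z $ i $ j) analytic_on \<real>" for i j
    using assms by (auto simp: analytic_matrix_def)
  show ?thesis
    by (simp add: vec_eq_iff matrix_mult_2_nth fcalc_matrix_nth fcalc_add fcalc_mult assms(1) an analytic_intros)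
qed

lemma scal_matrix_eq_fcalc_matrix:
  assumes "x \<in> V"
  shows "scal_matrix scal M = fcalc_matrix fcalc (\<lambda>_. M) x"
  using assms by (simp add: vec_eq_iff scal_matrix_def fcalc_matrix_nth fcalc_const)

lemma Rm_eq_fcalc_matrix:
  assumes "x \<in> V"
  shows "Rm = fcalc_matrix fcalc (\<lambda>_. Rm) x"
  using assms by (simp add: matrix_2_eq_iff Rm_def fcalc_matrix_nth fcalc_const scal_zero scal_one scal_minus)

lemma Lm_eq_fcalc_matrix:
  assumes "x \<in> V"
  shows "Lm = fcalc_matrix fcalc (\<lambda>_. Lm) x"
  using assms by (simp add: matrix_2_eq_iff Lm_eq fcalc_matrix_nth fcalc_const scal_zero scal_one scal_minus)

lemma Xm_eq_fcalc_matrix: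
  assumes "x \<in> V"
  shows "Xm scal fcalc x = fcalc_matrix fcalc shear_matrix x"
    and "Xm scal fcalc (- x) = fcalc_matrix fcalc (\<lambda>z. shear_matrix (- z)) x"
proof -
  have e: "fcalc exp (scal (1/2) * x) = fcalc (\<lambda>z. exp (z / 2)) x"
    "fcalc exp (- (scal (1/2) * x)) = fcalc (\<lambda>z. exp (- (z / 2))) x"
    using fcalc_exp_linear[OF assms, of "1/2"] fcalc_exp_linear[OF assms, of "-1/2"] by (simp_all add: scal_minus)
  have m: "fcalc (\<lambda>z. - exp (z / 2)) x = - fcalc (\<lambda>z. exp (z / 2)) x"
    "fcalc (\<lambda>z. - exp (- (z / 2))) x = - fcalc (\<lambda>z. exp (- (z / 2))) x"
    by (auto intro!: fcalc_minus[OF assms] analytic_intros)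
  show "Xm scal fcalc x = fcalc_matrix fcalc shear_matrix x"
    "Xm scal fcalc (- x) = fcalc_matrix fcalc (\<lambda>z. shear_matrix (- z)) x"
    by (simp_all add: matrix_2_eq_iff Xm_def fcalc_matrix_nth shear_matrix_def fcalc_const scal_zero assms e m)
qed

text \<open>\<open>u\<close> and \<open>u'\<close> stay where they are, and between them stand only
  functions of \<open>x\<close>, which commute. The operator identity thus reduces to a scalar one
  on the real axis.\<close>

lemma dressed_sandwich_entry:
  assumes "x \<in> V" "e = u * fcalc Q x" "e' = fcalc P x * u'"
    and an: "Q analytic_on \<real>" "P analytic_on \<real>" "k analytic_on \<real>" "k' analytic_on \<real>"
    and eq: "\<And>z. z \<in> \<real> \<Longrightarrow> k z = s * Q z * P z * k' z"
  shows "u * fcalc k x * u' = scal s * (e * fcalc k' x * e')"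
proof -
  have an': "(\<lambda>z. k' z * P z) analytic_on \<real>" "(\<lambda>z. Q z * (k' z * P z)) analytic_on \<real>"
    "(\<lambda>z. s * (Q z * (k' z * P z))) analytic_on \<real>"
    by (intro analytic_on_mult analytic_on_const an)+
  have "k z = s * (Q z * (k' z * P z))" if "z \<in> \<real>" for z
    unfolding eq[OF that] by (simp only: mult_ac)
  then have "fcalc k x = fcalc (\<lambda>z. s * (Q z * (k' z * P z))) x"
    by (rule fcalc_cong[OF assms(1) an(3) an'(3)])
  also have "\<dots> = scal s * (fcalc Q x * (fcalc k' x * fcalc P x))"
    by (simp only: fcalc_scale[OF assms(1) an'(2)] fcalc_mult[OF assms(1) an(1) an'(1)] fcalc_mult[OF assms(1) an(4,2)])
  finally have "u * fcalc k x * u' = (u * scal s) * (fcalc Q x * (fcalc k' x * fcalc P x)) * u'"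
    by (simp only: mult.assoc)
  then show ?thesis by (simp only: scal_central[of s u, symmetric] assms(2,3) mult.assoc)
qed

end

section \<open>The relations\<close>

text \<open>
  The values of the primitive \<open>G\<close> of the averaged dilogarithm at \<open>z\<close>, \<open>z + \<tau>\<close>, \<open>z - \<tau>\<close>, \<open>- z\<close>, \<open>- z + \<tau>\<close>
  and \<open>- z - \<tau>\<close> appear as \<open>p\<close>, \<open>pp\<close>, \<open>pm\<close>, \<open>n\<close>, \<open>np\<close> and \<open>nm\<close>.
\<close>

lemma exp_dressing_products:
  fixes p pp pm n np nm \<tau> z w C :: complex
  assumes "\<tau> \<noteq> 0"
    and quad: "exp ((pp - pm) / \<tau>) = 1 + w * exp z + exp z ^ 2" "exp ((np - nm) / \<tau>) = 1 + w * exp (- z) + exp (- z) ^ 2"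
    and refl: "p + n = C + z ^ 2 / 2" "pp + nm = C + (z + \<tau>) ^ 2 / 2"
  defines "E1 \<equiv> exp ((pp - p) / \<tau>)" and "E2 \<equiv> exp ((p - pm) / \<tau>)"
    and "B1 \<equiv> exp ((nm - n) / \<tau>)" and "B2 \<equiv> exp ((n - np) / \<tau>)"
    and "v \<equiv> exp z + w + exp (- z)"
  shows "E1 * E2 = exp z * v" "B1 * B2 * (exp (- z) * v) = 1" "E1 * B1 = exp (\<tau> / 2) * exp z"
    "E1 * inverse B2 = exp (\<tau> / 2) * v" "inverse E2 * inverse B2 = exp (\<tau> / 2) * exp (- z)"
    "inverse E2 * B1 * v = exp (\<tau> / 2)"
proof -
  define X Y q where "X = exp z" and "Y = exp (- z)" and "q = exp (\<tau> / 2)"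
  have XY: "X * Y = 1" "X \<noteq> 0" "Y \<noteq> 0" by (simp_all add: X_def Y_def flip: exp_add)
  have nz: "E1 \<noteq> 0" "E2 \<noteq> 0" "B1 \<noteq> 0" "B2 \<noteq> 0" by (simp_all add: E1_def E2_def B1_def B2_def)
  \<comment> \<open>\<open>v\<close> is the quadratic divided by \<open>exp z\<close>. It is even in
    \<open>z\<close>, so one \<open>v\<close> serves both arguments.\<close>
  have quad': "1 + w * X + X ^ 2 = X * v" "1 + w * Y + Y ^ 2 = Y * v"
    using XY(1) unfolding v_def X_def[symmetric] Y_def[symmetric] by algebra+
  have "E1 * E2 = exp ((pp - pm) / \<tau>)"
    by (simp add: E1_def E2_def flip: exp_add add_divide_distrib)
  then show 1: "E1 * E2 = exp z * v" unfolding quad using quad' by (simp add: X_def)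
  have "B1 * B2 * exp ((np - nm) / \<tau>) = exp ((nm - n) / \<tau> + (n - np) / \<tau> + (np - nm) / \<tau>)"
    by (simp add: B1_def B2_def exp_add)
  also have "(nm - n) / \<tau> + (n - np) / \<tau> + (np - nm) / \<tau> = 0"
    by (simp flip: add_divide_distrib)
  finally show 2: "B1 * B2 * (exp (- z) * v) = 1" unfolding quad using quad' by (simp add: Y_def)
  \<comment> \<open>Difference of the two reflections; completing the square, as
    \<open>((z + \<tau>)^2 - z^2) / (2 * \<tau>)\<close>, is the origin of
    \<open>exp (\<tau> / 2)\<close>.\<close>
  have "(pp - p) / \<tau> + (nm - n) / \<tau> = ((pp + nm) - (p + n)) / \<tau>"
    by (simp add: algebra_simps flip: add_divide_distrib)
  also have "\<dots> = \<tau> / 2 + z"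
    unfolding refl using \<open>\<tau> \<noteq> 0\<close> by (simp add: field_simps power2_eq_square)
  finally show 3: "E1 * B1 = exp (\<tau> / 2) * exp z"
    by (simp add: E1_def B1_def flip: exp_add)
  \<comment> \<open>The other products are algebra: \<open>inverse E2\<close> and
    \<open>inverse B2\<close> are expressed through \<open>E1\<close> and \<open>B1\<close>.\<close>
  have v: "v \<noteq> 0" using 2 by auto
  have B2: "inverse B2 = B1 * (Y * v)"
    using 2 by (intro inverse_unique) (simp add: Y_def mult_ac)
  have "E1 * inverse B2 = (E1 * B1) * (Y * v)" unfolding B2 by simp
  also have "\<dots> = q * (X * Y) * v" unfolding 3 by (simp add: X_def q_def mult_ac)
  finally show 4: "E1 * inverse B2 = exp (\<tau> / 2) * v" by (simp add: XY q_def)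
  have "inverse E2 * (X * v) = E1" using 1 nz by (simp add: X_def field_simps)
  then have E2: "inverse E2 = E1 * (Y * inverse v)"
    using XY v by (metis (no_types, opaque_lifting) inverse_unique mult.assoc mult.right_neutral nonzero_inverse_mult_distrib right_inverse inverse_mult_distrib)
  have "inverse E2 * inverse B2 = (E1 * inverse B2) * (Y * inverse v)" unfolding E2 by (simp add: mult_ac)
  then show "inverse E2 * inverse B2 = exp (\<tau> / 2) * exp (- z)"
    unfolding 4 using v by (simp add: Y_def)
  have "inverse E2 * B1 * v = (E1 * B1) * (Y * inverse v) * v" unfolding E2 by (simp add: mult_ac)
  also have "\<dots> = q * (X * Y)" unfolding 3 using v by (simp add: X_def q_def)
  finally show "inverse E2 * B1 * v = exp (\<tau> / 2)" by (simp add: XY q_def)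
qed

section \<open>From scalar identities to the operator relations\<close>

context operator_calculus
begin

text \<open>Row 1 of the inner matrix meets \<open>exp (- W / 2)\<close> and column 1 meets
  \<open>exp (Y / 2)\<close>. Hence rows 1 and 2 receive \<open>Qm\<close> and \<open>Qp\<close>,
  columns 1 and 2 receive \<open>Pp\<close> and \<open>Pm\<close>.\<close>

lemma dressed_sandwich:
  assumes x: "x \<in> V" and an: "analytic_matrix K" "analytic_matrix K'"
    "Qp analytic_on \<real>" "Qm analytic_on \<real>" "Pp analytic_on \<real>" "Pm analytic_on \<real>"
    and W: "fcalc exp (scal (1/2) * W') = fcalc exp (scal (1/2) * W) * fcalc Qp x"
      "fcalc exp (- (scal (1/2) * W')) = fcalc exp (- (scal (1/2) * W)) * fcalc Qm x"
    and Y: "fcalc exp (scal (1/2) * Y') = fcalc Pp x * fcalc exp (scal (1/2) * Y)"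
      "fcalc exp (- (scal (1/2) * Y')) = fcalc Pm x * fcalc exp (- (scal (1/2) * Y))"
    and K: "\<And>z. z \<in> \<real> \<Longrightarrow> K z $ 1 $ 1 = s * Qm z * Pp z * K' z $ 1 $ 1"
      "\<And>z. z \<in> \<real> \<Longrightarrow> K z $ 1 $ 2 = s * Qm z * Pm z * K' z $ 1 $ 2"
      "\<And>z. z \<in> \<real> \<Longrightarrow> K z $ 2 $ 1 = s * Qp z * Pp z * K' z $ 2 $ 1"
      "\<And>z. z \<in> \<real> \<Longrightarrow> K z $ 2 $ 2 = s * Qp z * Pm z * K' z $ 2 $ 2"
  shows "Xm scal fcalc W ** fcalc_matrix fcalc K x ** Xm scal fcalc Y
    = smult_matrix (scal s) (Xm scal fcalc W' ** fcalc_matrix fcalc K' x ** Xm scal fcalc Y')"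
proof -
  have k: "(\<lambda>z. K z $ i $ j) analytic_on \<real>" "(\<lambda>z. K' z $ i $ j) analytic_on \<real>" for i j
    using an by (auto simp: analytic_matrix_def)
  show ?thesis
    unfolding Xm_sandwich matrix_2_eq_iff smult_matrix_def fcalc_matrix_nth
    by (simp add: dressed_sandwich_entry[OF x W(2) Y(1) an(4,5) k K(1)]
        dressed_sandwich_entry[OF x W(2) Y(2) an(4,6) k K(2)]
        dressed_sandwich_entry[OF x W(1) Y(1) an(3,5) k K(3)]
        dressed_sandwich_entry[OF x W(1) Y(2) an(3,6) k K(4)])
qed

lemma Xm_products_eq_fcalc_matrix:
  assumes "x \<in> V" "N1 = fcalc_matrix fcalc (\<lambda>_. M1) x" "N2 = fcalc_matrix fcalc (\<lambda>_. M2) x"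
  shows "N1 ** Xm scal fcalc x ** scal_matrix scal M ** Xm scal fcalc x ** N2
      = fcalc_matrix fcalc (\<lambda>z. M1 ** (shear_matrix z ** M ** shear_matrix z) ** M2) x"
    and "N1 ** Xm scal fcalc (- x) ** scal_matrix scal M ** Xm scal fcalc (- x) ** N2
      = fcalc_matrix fcalc (\<lambda>z. M1 ** (shear_matrix (- z) ** M ** shear_matrix (- z)) ** M2) x"
  unfolding assms(2,3) Xm_eq_fcalc_matrix[OF assms(1)] scal_matrix_eq_fcalc_matrix[OF assms(1)]
  by (simp_all add: fcalc_matrix_mult assms(1) analytic_matrix_const analytic_matrix_mult analytic_matrix_shear
      flip: matrix_mul_assoc)

lemma analytic_matrix_conjugated_shear:
  "analytic_matrix (\<lambda>z. M1 ** (shear_matrix z ** M ** shear_matrix z) ** M2)"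
  "analytic_matrix (\<lambda>z. M1 ** (shear_matrix (- z) ** M ** shear_matrix (- z)) ** M2)"
  by (intro analytic_matrix_mult analytic_matrix_const analytic_matrix_shear)+

lemma fcalc_qdilog_shifted:
  assumes "x \<in> V" "h > 0" "0 \<le> \<phi>" "\<phi> < pi"
  shows "scal (1/2) * (fcalc (qdilog h) (x + scal (\<i> * of_real \<phi>)) + fcalc (qdilog h) (x - scal (\<i> * of_real \<phi>)))
      = fcalc (mean_dilog h \<phi>) x"
    and "scal (1/2) * (fcalc (qdilog h) (- x + scal (\<i> * of_real \<phi>)) + fcalc (qdilog h) (- x - scal (\<i> * of_real \<phi>)))
      = fcalc (\<lambda>z. mean_dilog h \<phi> (- z)) x"
proof -
  define r where "r = pi * (1 + h)"
  have r: "\<phi> < r" using assms mult_pos_pos[OF pi_gt_zero \<open>h > 0\<close>] unfolding r_def distrib_left by linarith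
  have an: "qdilog h analytic_on {z. \<bar>Im z\<bar> < r}"
    using holomorphic_on_qdilog[OF \<open>h > 0\<close>] open_strip by (simp add: analytic_on_open r_def)
  have eq: "fcalc (qdilog h) (scal (of_real s) * x + scal b) = fcalc (\<lambda>z. qdilog h (of_real s * z + b)) x"
    and an': "(\<lambda>z. qdilog h (of_real s * z + b)) analytic_on \<real>"
    if "b = \<i> * of_real \<phi> \<or> b = - \<i> * of_real \<phi>" for s b
  proof -
    have b: "\<bar>Im b\<bar> < r" using that r assms by auto
    show "fcalc (qdilog h) (scal (of_real s) * x + scal b) = fcalc (\<lambda>z. qdilog h (of_real s * z + b)) x"
      by (rule fcalc_real_affine[OF assms(1) an b])
    have "(\<lambda>z. of_real s * z + b) ` \<real> \<subseteq> {z. \<bar>Im z\<bar> < r}" using b by (auto simp: complex_is_Real_iff)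
    then show "(\<lambda>z. qdilog h (of_real s * z + b)) analytic_on \<real>"
      using analytic_on_compose_gen[of "\<lambda>z. of_real s * z + b" \<real> "qdilog h" "{z. \<bar>Im z\<bar> < r}"] an
        analytic_on_add[OF analytic_on_mult[OF analytic_on_const analytic_on_ident] analytic_on_const]
      by (simp add: o_def image_subset_iff)
  qed
  have sum: "scal (1/2) * (fcalc (qdilog h) (scal (of_real s) * x + scal b) + fcalc (qdilog h) (scal (of_real s) * x + scal b'))
      = fcalc (\<lambda>z. 1 / 2 * (qdilog h (of_real s * z + b) + qdilog h (of_real s * z + b'))) x"
    if "b = \<i> * of_real \<phi>" "b' = - \<i> * of_real \<phi>" for s b b'
  proof -
    have "b = \<i> * of_real \<phi> \<or> b = - \<i> * of_real \<phi>" "b' = \<i> * of_real \<phi> \<or> b' = - \<i> * of_real \<phi>"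
      using that by simp_all
    note bs = this
    show ?thesis
      by (simp only: eq[OF bs(1)] eq[OF bs(2)] fcalc_add[OF assms(1) an'[OF bs(1)] an'[OF bs(2)]]
          fcalc_scale[OF assms(1) analytic_on_add[OF an'[OF bs(1)] an'[OF bs(2)]]])
  qed
  show "scal (1/2) * (fcalc (qdilog h) (x + scal (\<i> * of_real \<phi>)) + fcalc (qdilog h) (x - scal (\<i> * of_real \<phi>)))
      = fcalc (mean_dilog h \<phi>) x"
    using sum[OF refl refl, of 1] by (simp add: scal_one scal_minus mean_dilog_def[abs_def])
  show "scal (1/2) * (fcalc (qdilog h) (- x + scal (\<i> * of_real \<phi>)) + fcalc (qdilog h) (- x - scal (\<i> * of_real \<phi>)))
      = fcalc (\<lambda>z. mean_dilog h \<phi> (- z)) x"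
    using sum[OF refl refl, of "-1"] by (simp add: scal_one scal_minus mean_dilog_def)
qed

text \<open>The graph enters only through the two commutators with \<open>Z\<close>. Exponentials of
  \<open>A\<close> and \<open>B\<close> keep their places at the ends; everything between them is a
  function of \<open>Z\<close>.\<close>

lemma pending_flip_relations:
  assumes Z: "Z \<in> V" and A: "\<And>r. scal (of_real r) * A \<in> V" and B: "\<And>r. scal (of_real r) * B \<in> V"
    and comm: "A * Z - Z * A = scal (- 2 * \<tau>)" "B * Z - Z * B = scal (2 * \<tau>)"
    and h: "h > 0" and \<phi>: "0 \<le> \<phi>" "\<phi> < pi"
    and w: "w = exp (\<i> * of_real \<phi>) + exp (- \<i> * of_real \<phi>)"
    and \<tau>: "\<tau> = \<i> * of_real pi * of_real h" and qhalf: "qhalf = exp (\<tau> / 2)"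
    and At: "At = A + fcalc (qdilog h) (Z + scal (\<i> * of_real \<phi>)) + fcalc (qdilog h) (Z - scal (\<i> * of_real \<phi>))"
    and Bt: "Bt = B - fcalc (qdilog h) (- Z + scal (\<i> * of_real \<phi>)) - fcalc (qdilog h) (- Z - scal (\<i> * of_real \<phi>))"
    and X: "X = Xm scal fcalc" and \<Omega>: "\<Omega> = Omega w a c"
  shows "X A ** Lm ** X Z ** scal_matrix scal (Fm w ** \<Omega>) ** X Z ** Lm ** X B
      = smult_matrix (scal (inverse qhalf))
          (X At ** Rm ** X (- Z) ** scal_matrix scal (- \<Omega>) ** X (- Z) ** Rm ** X Bt)"
    and "X A ** Lm ** X Z ** scal_matrix scal \<Omega> ** X Z ** Rm ** X A
      = X At ** Rm ** X (- Z) ** scal_matrix scal \<Omega> ** X (- Z) ** Lm ** X At"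
    and "X B ** Rm ** X Z ** scal_matrix scal \<Omega> ** X Z ** Lm ** X B
      = X Bt ** Lm ** X (- Z) ** scal_matrix scal \<Omega> ** X (- Z) ** Rm ** X Bt"
proof -
  obtain G where G: "\<And>z. \<bar>Im z\<bar> < pi * (1 + h) - \<phi> \<Longrightarrow> (G has_field_derivative mean_dilog h \<phi> z) (at z)"
    and refl: "\<And>z. \<bar>Im z\<bar> < pi * (1 + h) - \<phi> \<Longrightarrow> G z + G (- z) = 2 * G 0 + z ^ 2 / 2"
    and quad: "\<And>z. \<bar>Im z\<bar> < pi - \<phi> \<Longrightarrow> exp ((G (z + \<tau>) - G (z - \<tau>)) / \<tau>) = 1 + w * exp z + exp z ^ 2"
    using mean_dilog_primitive[OF h \<phi> w \<tau>] by blast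
  define r where "r = pi * (1 + h) - \<phi>"
  have ph: "pi * h > 0" using h by simp
  have \<tau>r: "\<tau> \<noteq> 0" "Re \<tau> = 0" "\<bar>Im \<tau>\<bar> < r" "- \<tau> \<noteq> 0" "Re (- \<tau>) = 0" "\<bar>Im (- \<tau>)\<bar> < r"
    using h \<phi> ph by (auto simp: \<tau> r_def distrib_left)
  \<comment> \<open>The dressings are \<open>exp (At/2) = exp (A/2) E1(Z) = E2(Z) exp (A/2)\<close>
    and \<open>exp (Bt/2) = exp (B/2) B2(Z) = B1(Z) exp (B/2)\<close>. For negative exponents the
    inverses occur with the positions exchanged.\<close>
  define E1 where "E1 z = exp ((G (z + \<tau>) - G z) / \<tau>)" for z
  define E2 where "E2 z = exp ((G z - G (z - \<tau>)) / \<tau>)" for z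
  define B1 where "B1 z = exp ((G (- z - \<tau>) - G (- z)) / \<tau>)" for z
  define B2 where "B2 z = exp ((G (- z) - G (- z + \<tau>)) / \<tau>)" for z
  let ?\<Phi> = "mean_dilog h \<phi>"
  have G': "((\<lambda>z. - G z) has_field_derivative - ?\<Phi> z) (at z)"
    "((\<lambda>z. G (- z)) has_field_derivative - ?\<Phi> (- z)) (at z)"
    "((\<lambda>z. - G (- z)) has_field_derivative ?\<Phi> (- z)) (at z)" if "\<bar>Im z\<bar> < r" for z
  proof -
    have z: "\<bar>Im z\<bar> < pi * (1 + h) - \<phi>" "\<bar>Im (- z)\<bar> < pi * (1 + h) - \<phi>" using that by (simp_all add: r_def)
    show "((\<lambda>z. - G z) has_field_derivative - ?\<Phi> z) (at z)" by (rule DERIV_minus[OF G[OF z(1)]])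
    have "((\<lambda>z. G (- z)) has_field_derivative ?\<Phi> (- z) * (- 1)) (at z)"
      by (rule DERIV_chain2[where f=G and g=uminus, OF G[OF z(2)]]) (auto intro!: derivative_eq_intros)
    then show 1: "((\<lambda>z. G (- z)) has_field_derivative - ?\<Phi> (- z)) (at z)" by simp
    from DERIV_minus[OF 1] show "((\<lambda>z. - G (- z)) has_field_derivative ?\<Phi> (- z)) (at z)" by simp
  qed
  have half_comm: "scal a * C * Z - Z * (scal a * C) = scal (a * b)" if "C * Z - Z * C = scal b" for a b C
  proof -
    have "Z * (scal a * C) = scal a * (Z * C)" by (metis mult.assoc scal_central)
    then have "scal a * C * Z - Z * (scal a * C) = scal a * (C * Z - Z * C)" by (simp add: mult.assoc right_diff_distrib)
    then show ?thesis by (simp add: that scal_mult)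
  qed
  have V: "scal (1/2) * A \<in> V" "- (scal (1/2) * A) \<in> V" "scal (1/2) * B \<in> V" "- (scal (1/2) * B) \<in> V"
    using A[of "1/2"] A[of "-1/2"] B[of "1/2"] B[of "-1/2"] by (simp_all add: scal_minus)
  have commA: "scal (1/2) * A * Z - Z * (scal (1/2) * A) = scal (- \<tau>)"
    "- (scal (1/2) * A) * Z - Z * - (scal (1/2) * A) = scal \<tau>"
    using half_comm[OF comm(1), of "1/2"] half_comm[OF comm(1), of "-1/2"] by (simp_all add: scal_minus)
  have commB: "scal (1/2) * B * Z - Z * (scal (1/2) * B) = scal \<tau>"
    "- (scal (1/2) * B) * Z - Z * - (scal (1/2) * B) = scal (- \<tau>)"
    using half_comm[OF comm(2), of "1/2"] half_comm[OF comm(2), of "-1/2"] by (simp_all add: scal_minus)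
  have an\<Phi>: "?\<Phi> analytic_on \<real>" "(\<lambda>z. ?\<Phi> (- z)) analytic_on \<real>"
  proof -
    have "?\<Phi> analytic_on {z. \<bar>Im z\<bar> < r}"
      using holomorphic_on_mean_dilog[OF h \<phi>(1)] open_strip by (simp add: analytic_on_open r_def)
    moreover have "r > 0" using \<tau>r by linarith
    then have "\<real> \<subseteq> {z. \<bar>Im z\<bar> < r}" by (auto simp: complex_is_Real_iff)
    ultimately show 1: "?\<Phi> analytic_on \<real>" by (rule analytic_on_subset)
    have "uminus ` \<real> \<subseteq> (\<real> :: complex set)" by auto
    then have "?\<Phi> analytic_on uminus ` \<real>" using 1 analytic_on_subset by blast
    then show "(\<lambda>z. ?\<Phi> (- z)) analytic_on \<real>"
      using analytic_on_compose[of uminus \<real> ?\<Phi>] analytic_on_neg[OF analytic_on_ident] by (simp add: o_def)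
  qed
  have At': "scal (1/2) * At = scal (1/2) * A + fcalc ?\<Phi> Z"
    "- (scal (1/2) * At) = - (scal (1/2) * A) + fcalc (\<lambda>z. - ?\<Phi> z) Z"
    by (simp_all add: At distrib_left add.assoc fcalc_minus Z an\<Phi> flip: fcalc_qdilog_shifted(1)[OF Z h \<phi>])
  have Bt': "scal (1/2) * Bt = scal (1/2) * B + fcalc (\<lambda>z. - ?\<Phi> (- z)) Z"
    "- (scal (1/2) * Bt) = - (scal (1/2) * B) + fcalc (\<lambda>z. ?\<Phi> (- z)) Z"
    by (simp_all add: Bt distrib_left right_diff_distrib diff_diff_eq fcalc_minus Z an\<Phi> flip: fcalc_qdilog_shifted(2)[OF Z h \<phi>])
  have GT: "(G has_field_derivative ?\<Phi> z) (at z)" if "\<bar>Im z\<bar> < r" for z using G that by (simp add: r_def)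
  \<comment> \<open>Negating the exponent flips both the commutator and the primitive, and
    \<open>A\<close> and \<open>B\<close> have opposite commutators: the pairs are
    \<open>- \<tau>\<close> with \<open>G z\<close>, \<open>\<tau>\<close> with
    \<open>- G z\<close>, \<open>\<tau>\<close> with \<open>G (- z)\<close> and
    \<open>- \<tau>\<close> with \<open>- G (- z)\<close>.\<close>
  note dA = dressed_exponential[OF V(1) Z commA(1) \<tau>r(4-6) GT]
  note dA' = dressed_exponential[OF V(2) Z commA(2) \<tau>r(1-3) G'(1)]
  note dB = dressed_exponential[OF V(3) Z commB(1) \<tau>r(1-3) G'(2)]
  note dB' = dressed_exponential[OF V(4) Z commB(2) \<tau>r(4-6) G'(3)]
  have funs: "(\<lambda>z. exp ((G z - G (z - - \<tau>)) / - \<tau>)) = E1" "(\<lambda>z. exp ((G (z + - \<tau>) - G z) / - \<tau>)) = E2"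
    "(\<lambda>z. exp ((- G z - - G (z - \<tau>)) / \<tau>)) = (\<lambda>z. inverse (E2 z))"
    "(\<lambda>z. exp ((- G (z + \<tau>) - - G z) / \<tau>)) = (\<lambda>z. inverse (E1 z))"
    "(\<lambda>z. exp ((G (- z) - G (- (z - \<tau>))) / \<tau>)) = B2" "(\<lambda>z. exp ((G (- (z + \<tau>)) - G (- z)) / \<tau>)) = B1"
    "(\<lambda>z. exp ((- G (- z) - - G (- (z - - \<tau>))) / - \<tau>)) = (\<lambda>z. inverse (B1 z))"
    "(\<lambda>z. exp ((- G (- (z + - \<tau>)) - - G (- z)) / - \<tau>)) = (\<lambda>z. inverse (B2 z))"
    by (simp_all add: fun_eq_iff E1_def E2_def B1_def B2_def add.commute diff_divide_distrib add_divide_distrib flip: exp_minus)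
  note dA = dA[unfolded funs, folded At'] and dA' = dA'[unfolded funs, folded At']
  note dB = dB[unfolded funs, folded Bt'] and dB' = dB'[unfolded funs, folded Bt']
  \<comment> \<open>The reflection is used at \<open>z\<close> and at \<open>z + \<tau>\<close>; the
    latter is admissible because \<open>pi * h < pi * (1 + h) - \<phi>\<close>.\<close>
  have prods: "E1 z * E2 z = exp z * v" "B1 z * B2 z * (exp (- z) * v) = 1" "E1 z * B1 z = qhalf * exp z"
      "E1 z * inverse (B2 z) = qhalf * v" "inverse (E2 z) * inverse (B2 z) = qhalf * exp (- z)"
      "inverse (E2 z) * B1 z * v = qhalf"
    if "z \<in> \<real>" "v = exp z + w + exp (- z)" for z v
  proof -
    have im: "Im z = 0" using that by (simp add: complex_is_Real_iff)
    have *: "\<bar>Im z\<bar> < pi - \<phi>" "\<bar>Im (- z)\<bar> < pi - \<phi>" "\<bar>Im z\<bar> < pi * (1 + h) - \<phi>" "\<bar>Im (z + \<tau>)\<bar> < pi * (1 + h) - \<phi>"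
      using im \<phi> ph \<tau>r by (simp_all add: r_def distrib_left)
    have "G (z + \<tau>) + G (- z - \<tau>) = 2 * G 0 + (z + \<tau>) ^ 2 / 2"
      using refl[OF *(4)] by (simp only: minus_add_distrib diff_conv_add_uminus)
    note P = exp_dressing_products[OF \<tau>r(1) quad[OF *(1)] quad[OF *(2)] refl[OF *(3)] this,
      folded E1_def E2_def B1_def B2_def qhalf that(2)]
    show "E1 z * E2 z = exp z * v" "B1 z * B2 z * (exp (- z) * v) = 1" "E1 z * B1 z = qhalf * exp z"
      "E1 z * inverse (B2 z) = qhalf * v" "inverse (E2 z) * inverse (B2 z) = qhalf * exp (- z)"
      "inverse (E2 z) * B1 z * v = qhalf"
      by (rule P)+
  qed
  have nz: "E1 z \<noteq> 0" "E2 z \<noteq> 0" "B1 z \<noteq> 0" "B2 z \<noteq> 0" "qhalf \<noteq> 0" for z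
    by (simp_all add: E1_def E2_def B1_def B2_def qhalf)
  have XY: "exp z * exp (- z) = 1" for z :: complex by (simp flip: exp_add)
  note entries = matrix_mult_2_nth shear_matrix_sandwich Lm_eq Rm_def Omega_def Fm_def \<Omega>
  note fm = Xm_products_eq_fcalc_matrix[OF Z, folded X]
  note L = Lm_eq_fcalc_matrix[OF Z] and R = Rm_eq_fcalc_matrix[OF Z]
  have XZ: "exp (- z) * (exp z * t) = t" "exp z * (exp (- z) * t) = t" for z t :: complex
    by (simp_all add: XY mult.commute[of "exp (- z)"] flip: mult.assoc)
  have cancel: "t * v = exp (- z)" if "t * (exp z * v) = 1" for t v z :: complex
  proof -
    have "t * v = exp (- z) * (exp z * (t * v))" by (simp only: XZ)
    also have "exp z * (t * v) = t * (exp z * v)" by (simp only: mult.left_commute)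
    finally show ?thesis unfolding that by simp
  qed
  let ?KF = "\<lambda>z. Lm ** (shear_matrix z ** (Fm w ** \<Omega>) ** shear_matrix z) ** Lm"
  let ?KF' = "\<lambda>z. Rm ** (shear_matrix (- z) ** (- \<Omega>) ** shear_matrix (- z)) ** Rm"
  \<comment> \<open>The factor \<open>exp z + w + exp (- z)\<close> stands in entry 22 here but in
    entry 11 of \<open>?KF'\<close>; the dressing factors have to move it.\<close>
  have KF: "?KF z $ 1 $ 1 = - c" "?KF z $ 1 $ 2 = exp (- z) * (a - w * c) - c"
    "?KF z $ 2 $ 1 = c - exp z * (a - w * c)" "?KF z $ 2 $ 2 = - (a - w * c) * (exp z + w + exp (- z))" for z
    by (simp_all add: entries algebra_simps)
  have KF': "?KF' z $ 1 $ 1 = - c * (exp z + w + exp (- z))" "?KF' z $ 1 $ 2 = a - w * c - exp z * c"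
    "?KF' z $ 2 $ 1 = exp (- z) * c - (a - w * c)" "?KF' z $ 2 $ 2 = - (a - w * c)" for z
    by (simp_all add: entries algebra_simps)
  \<comment> \<open>The right-hand sides of the second and third relations are
    \<open>?RL (- z)\<close> and \<open>?LR (- z)\<close>, so these two tables cover all four
    matrices.\<close>
  let ?LR = "\<lambda>z. Lm ** (shear_matrix z ** \<Omega> ** shear_matrix z) ** Rm"
  let ?RL = "\<lambda>z. Rm ** (shear_matrix z ** \<Omega> ** shear_matrix z) ** Lm"
  have LR: "?LR z $ 1 $ 1 = c * exp (- z) + a" "?LR z $ 1 $ 2 = c * exp (- z)"
    "?LR z $ 2 $ 1 = - c * (exp z + w + exp (- z))" "?LR z $ 2 $ 2 = a - w * c - c * exp (- z)" for z
    by (simp_all add: entries algebra_simps)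
  have RL: "?RL z $ 1 $ 1 = c * exp z + a" "?RL z $ 1 $ 2 = c * (exp z + w + exp (- z))"
    "?RL z $ 2 $ 1 = - c * exp z" "?RL z $ 2 $ 2 = a - w * c - c * exp z" for z
    by (simp_all add: entries algebra_simps)
  have "X A ** (Lm ** X Z ** scal_matrix scal (Fm w ** \<Omega>) ** X Z ** Lm) ** X B
      = smult_matrix (scal (inverse qhalf))
          (X At ** (Rm ** X (- Z) ** scal_matrix scal (- \<Omega>) ** X (- Z) ** Rm) ** X Bt)"
    unfolding fm(1)[OF L L] fm(2)[OF R R] unfolding X
  \<comment> \<open>In \<open>dA\<close> and its companions, (1) and (3) concern the factor left of
    the exponential, (2) and (4) the one right of it. The left end takes the latter and the right
    end the former, so that all factors face the inner matrix.\<close>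
  proof (rule dressed_sandwich[OF Z analytic_matrix_conjugated_shear dA(4) dA'(4) dB(3) dB'(3) dA(2) dA'(2) dB(1) dB'(1)])
    fix z :: complex assume z: "z \<in> \<real>"
    define v where "v = exp z + w + exp (- z)"
    note P = prods[OF z v_def]
    have s: "inverse qhalf * (qhalf * t) = t" for t using nz(5) by simp
    \<comment> \<open>Each of the four mixed products of an \<open>A\<close> factor with a
      \<open>B\<close> factor contains \<open>qhalf\<close> once; a single scalar in front therefore
      corrects all entries.\<close>
    have 11: "inverse qhalf * inverse (E2 z) * B1 z * v = 1" using P(6) nz(5) by (simp add: mult.assoc)
    have 12: "inverse qhalf * inverse (E2 z) * inverse (B2 z) = exp (- z)" by (simp only: mult.assoc P(5) s)
    have 21: "inverse qhalf * E1 z * B1 z = exp z" by (simp only: mult.assoc P(3) s)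
    have 22: "inverse qhalf * E1 z * inverse (B2 z) = v" by (simp only: mult.assoc P(4) s)
    have "- c = inverse qhalf * inverse (E2 z) * B1 z * v * - c" unfolding 11 by simp
    then show "?KF z $ 1 $ 1 = inverse qhalf * inverse (E2 z) * B1 z * ?KF' z $ 1 $ 1"
      unfolding KF KF' v_def by (simp add: mult_ac)
    show "?KF z $ 1 $ 2 = inverse qhalf * inverse (E2 z) * inverse (B2 z) * ?KF' z $ 1 $ 2"
      unfolding KF KF' 12 by (simp add: right_diff_distrib XZ)
    show "?KF z $ 2 $ 1 = inverse qhalf * E1 z * B1 z * ?KF' z $ 2 $ 1"
      unfolding KF KF' 21 by (simp add: right_diff_distrib XZ)
    show "?KF z $ 2 $ 2 = inverse qhalf * E1 z * inverse (B2 z) * ?KF' z $ 2 $ 2"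
      unfolding KF KF' 22 v_def by (simp add: mult_ac)
  qed
  then show "X A ** Lm ** X Z ** scal_matrix scal (Fm w ** \<Omega>) ** X Z ** Lm ** X B
      = smult_matrix (scal (inverse qhalf))
          (X At ** Rm ** X (- Z) ** scal_matrix scal (- \<Omega>) ** X (- Z) ** Rm ** X Bt)"
    by (simp only: matrix_mul_assoc)
  have one: "smult_matrix (scal 1) M = M" for M by (simp add: smult_matrix_def scal_one vec_eq_iff)
  have "X A ** (Lm ** X Z ** scal_matrix scal \<Omega> ** X Z ** Rm) ** X A
      = smult_matrix (scal 1) (X At ** (Rm ** X (- Z) ** scal_matrix scal \<Omega> ** X (- Z) ** Lm) ** X At)"
    unfolding fm(1)[OF L R] fm(2)[OF R L] unfolding X
  proof (rule dressed_sandwich[OF Z analytic_matrix_conjugated_shear dA(4) dA'(4) dA(3) dA'(3) dA(2) dA'(2) dA(1) dA'(1)])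
    fix z :: complex assume z: "z \<in> \<real>"
    define v where "v = exp z + w + exp (- z)"
    note P = prods[OF z v_def]
    \<comment> \<open>With \<open>A\<close> at both ends the factors cancel in the diagonal entries,
      and \<open>E1 * E2 = exp z * v\<close> settles the others; no power of \<open>qhalf\<close>
      remains.\<close>
    have 12: "inverse (E2 z) * inverse (E1 z) * (exp z * v) = 1"
      unfolding P(1)[symmetric] using nz(1,2)[of z] by (simp add: field_simps)
    have "c * exp (- z) = c * (inverse (E2 z) * inverse (E1 z) * v)" unfolding cancel[OF 12] ..
    also have "\<dots> = inverse (E2 z) * inverse (E1 z) * (c * v)" by (simp only: mult_ac)
    finally show "?LR z $ 1 $ 2 = 1 * inverse (E2 z) * inverse (E1 z) * ?RL (- z) $ 1 $ 2"
      unfolding LR RL by (simp only: v_def add_ac minus_minus mult_1)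
    have 21: "E1 z * E2 z = exp z * v" by (rule P(1))
    show "?LR z $ 2 $ 1 = 1 * E1 z * E2 z * ?RL (- z) $ 2 $ 1"
      unfolding LR RL mult_1 21 v_def by (simp add: mult_ac XZ)
    show "?LR z $ 1 $ 1 = 1 * inverse (E2 z) * E2 z * ?RL (- z) $ 1 $ 1"
      "?LR z $ 2 $ 2 = 1 * E1 z * inverse (E1 z) * ?RL (- z) $ 2 $ 2"
      unfolding LR RL using nz by simp_all
  qed
  then show "X A ** Lm ** X Z ** scal_matrix scal \<Omega> ** X Z ** Rm ** X A
      = X At ** Rm ** X (- Z) ** scal_matrix scal \<Omega> ** X (- Z) ** Lm ** X At"
    by (simp only: matrix_mul_assoc one)
  have "X B ** (Rm ** X Z ** scal_matrix scal \<Omega> ** X Z ** Lm) ** X B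
      = smult_matrix (scal 1) (X Bt ** (Lm ** X (- Z) ** scal_matrix scal \<Omega> ** X (- Z) ** Rm) ** X Bt)"
    unfolding fm(1)[OF R L] fm(2)[OF L R] unfolding X
  proof (rule dressed_sandwich[OF Z analytic_matrix_conjugated_shear dB(4) dB'(4) dB(3) dB'(3) dB(2) dB'(2) dB(1) dB'(1)])
    fix z :: complex assume z: "z \<in> \<real>"
    define v where "v = exp z + w + exp (- z)"
    note P = prods[OF z v_def]
    have 21: "B2 z * B1 z * (exp (- z) * v) = 1" using P(2) by (simp add: mult_ac)
    have 12: "inverse (B1 z) * inverse (B2 z) = exp (- z) * v"
      using P(2) nz by (metis inverse_mult_distrib inverse_unique)
    show "?RL z $ 1 $ 2 = 1 * inverse (B1 z) * inverse (B2 z) * ?LR (- z) $ 1 $ 2"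
      unfolding LR RL mult_1 12 v_def by (simp add: mult_ac XZ)
    have "B2 z * B1 z * v = exp z" using cancel[of "B2 z * B1 z" "- z" v] 21 by simp
    then have "- c * exp z = - c * (B2 z * B1 z * v)" by simp
    also have "\<dots> = B2 z * B1 z * (- c * v)" by (simp only: mult_ac)
    finally show "?RL z $ 2 $ 1 = 1 * B2 z * B1 z * ?LR (- z) $ 2 $ 1"
      unfolding LR RL by (simp only: v_def add_ac minus_minus mult_1)
    show "?RL z $ 1 $ 1 = 1 * inverse (B1 z) * B1 z * ?LR (- z) $ 1 $ 1"
      "?RL z $ 2 $ 2 = 1 * B2 z * inverse (B2 z) * ?LR (- z) $ 2 $ 2"
      unfolding LR RL using nz by simp_all
  qed
  then show "X B ** Rm ** X Z ** scal_matrix scal \<Omega> ** X Z ** Lm ** X B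
      = X Bt ** Lm ** X (- Z) ** scal_matrix scal \<Omega> ** X (- Z) ** Rm ** X Bt"
    by (simp only: matrix_mul_assoc one)
qed

end

section \<open>Commutators with the pending variable\<close>

context orbifold_fat_graph
begin

text \<open>The one-valent end has no corner in the sum, so the pending edge occurs in just two
  corners, both at the vertex of \<open>opp d\<close>. The last assumption separates their
  contributions: if the other two edges coincided, they would cancel.\<close>

lemma bracket_pending:
  assumes "d \<in> D" "rot d = d" "rot (opp d) \<noteq> opp d"
    and ne: "edge opp (rot (opp d)) \<noteq> edge opp (rot (rot (opp d)))"
  shows "bracket D rot opp (edge opp (rot (opp d))) (edge opp d) = - 1"
    and "bracket D rot opp (edge opp (rot (rot (opp d)))) (edge opp d) = 1"
proof -
  define e x y where "e = opp d" and "x = rot e" and "y = rot x"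
  have D: "e \<in> D" "x \<in> D" "y \<in> D"
    using assms(1) opp_closed rot_closed by (simp_all add: e_def x_def y_def)
  have rot3: "rot y = e" using rot_valency[OF D(1)] by (simp add: x_def y_def)
  have opp: "e \<noteq> d" "opp e = d" using opp_involution[OF assms(1)] by (simp_all add: e_def)
  have xe: "x \<noteq> e" using assms(3) by (simp add: x_def e_def)
  have ye: "y \<noteq> e" using xe rot3 by (auto simp: x_def)
  have edge_d: "edge opp g = edge opp d \<longleftrightarrow> g = d \<or> g = e" for g
  proof
    assume "edge opp g = edge opp d"
    moreover have "g \<in> edge opp g" by (simp add: edge_def)
    ultimately have "g \<in> edge opp d" by simp
    then show "g = d \<or> g = e" by (simp add: edge_def e_def)
  next
    assume "g = d \<or> g = e"
    then show "edge opp g = edge opp d" using opp by (auto simp: edge_def e_def)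
  qed
  have to_d: "edge opp (rot g) = edge opp d \<longleftrightarrow> g = y" if "g \<in> D" "rot g \<noteq> g" for g
  proof
    assume "edge opp (rot g) = edge opp d"
    then consider "rot g = d" | "rot g = e" using edge_d by blast
    then show "g = y"
    proof cases
      \<comment> \<open>\<open>rot\<close> fixes \<open>d\<close>, so \<open>rot g = d\<close> and
        \<open>rot (rot (rot g)) = g\<close> force \<open>g = d\<close>, contrary to
        \<open>rot g \<noteq> g\<close>.\<close>
      case 1
      then show ?thesis using rot_valency[OF that(1)] that(2) assms(2) by simp
    next
      case 2
      then show ?thesis using rot_valency[OF that(1)] by (simp add: x_def y_def)
    qed
  qed (simp add: rot3 edge_d)
  have from_d: "edge opp g = edge opp d \<longleftrightarrow> g = e" if "rot g \<noteq> g" for g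
    using that assms(2) edge_d by auto
  let ?S = "{g \<in> D. rot g \<noteq> g}"
  have S: "finite ?S" "e \<in> ?S" "y \<in> ?S"
    using finite_darts D xe ye rot3 by (auto simp: x_def)
  \<comment> \<open>The corner from \<open>e\<close> to \<open>x\<close> reads \<open>Z\<close>
    before \<open>A\<close>, which counts negatively for the pair \<open>A\<close>,
    \<open>Z\<close>; for \<open>B\<close> the corner from \<open>y\<close> to \<open>e\<close>
    counts positively.\<close>
  have "bracket D rot opp (edge opp x) (edge opp d) = (\<Sum>g\<in>?S. if g = e then - 1 else 0)"
    unfolding bracket_def
  proof (rule sum.cong)
    fix g assume "g \<in> ?S"
    then show "(if edge opp g = edge opp x \<and> edge opp (rot g) = edge opp d then 1 else 0)
        - (if edge opp g = edge opp d \<and> edge opp (rot g) = edge opp x then 1 else 0) = (if g = e then - 1 else (0::int))"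
      using to_d[of g] from_d[of g] ne by (simp add: e_def[symmetric] x_def[symmetric] y_def[symmetric]) (auto simp: x_def)
  qed simp
  also have "\<dots> = - 1" using S by (simp add: sum.delta)
  finally show "bracket D rot opp (edge opp (rot (opp d))) (edge opp d) = - 1" by (simp add: x_def e_def)
  have "bracket D rot opp (edge opp y) (edge opp d) = (\<Sum>g\<in>?S. if g = y then 1 else 0)"
    unfolding bracket_def
  proof (rule sum.cong)
    fix g assume "g \<in> ?S"
    then show "(if edge opp g = edge opp y \<and> edge opp (rot g) = edge opp d then 1 else 0)
        - (if edge opp g = edge opp d \<and> edge opp (rot g) = edge opp y then 1 else 0) = (if g = y then 1 else (0::int))"
      using to_d[of g] from_d[of g] ne by (simp add: e_def[symmetric] x_def[symmetric] y_def[symmetric]) (auto simp: x_def)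
  qed simp
  also have "\<dots> = 1" using S by (simp add: sum.delta)
  finally show "bracket D rot opp (edge opp (rot (rot (opp d)))) (edge opp d) = 1" by (simp add: y_def x_def e_def)
qed

end

text \<open>Puts the exponents \<open>\<plusminus>A/2\<close> and \<open>\<plusminus>B/2\<close>
  into \<open>V\<close>, outside of which exponentials are not governed by the standard rule. The
  coefficients are concentrated at \<open>x\<close>.\<close>

lemma scaled_mem_real_span:
  assumes "finite S" "x \<in> S" "scal 0 = 0"
  shows "scal (of_real r) * x \<in> real_span scal S"
proof -
  have "(\<Sum>y\<in>S. scal (of_real (if y = x then r else 0)) * y) = (\<Sum>y\<in>S. if y = x then scal (of_real r) * x else 0)"
    by (rule sum.cong) (auto simp: assms(3))
  also have "\<dots> = scal (of_real r) * x" using assms by simp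
  finally have "scal (of_real r) * x = (\<Sum>y\<in>S. scal (of_real (if y = x then r else 0)) * y)" ..
  then show ?thesis
    unfolding real_span_def mem_Collect_eq by (intro exI[of _ "\<lambda>y. if y = x then r else 0"] conjI TrueI)
qed

theorem lemma6:
  fixes D :: "'d set" and rot opp :: "'d \<Rightarrow> 'd" and ordp :: "'d \<Rightarrow> nat" and h :: real
    and scal :: "complex \<Rightarrow> 'op::ring_1" and adj :: "'op \<Rightarrow> 'op"
    and fcalc :: "(complex \<Rightarrow> complex) \<Rightarrow> 'op \<Rightarrow> 'op" and Zq :: "'d set \<Rightarrow> 'op"
    and d :: 'd and p :: nat and \<phi> :: real and w qhalf a c :: complex
    and Z A B At Bt Zt :: 'op and X :: "'op \<Rightarrow> 'op^2^2" and F \<Omega> :: "complex^2^2"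
  assumes "quantum_fat_graph D rot opp ordp h scal adj fcalc Zq"
    and "d \<in> D" and "rot d = d" and "rot (opp d) \<noteq> opp d"
    and "edge opp (rot (opp d)) \<noteq> edge opp (rot (rot (opp d)))"
    and "p = ordp d"
    and "\<phi> = pi / real p"
    and "w = exp (\<i> * of_real \<phi>) + exp (- \<i> * of_real \<phi>)"
    and "qhalf = exp (\<i> * of_real pi * of_real h / 2)"
    and "Z = Zq (edge opp d)"
    and "A = Zq (edge opp (rot (opp d)))"
    and "B = Zq (edge opp (rot (rot (opp d))))"
    and "At = A + fcalc (qdilog h) (Z + scal (\<i> * of_real \<phi>))
                + fcalc (qdilog h) (Z - scal (\<i> * of_real \<phi>))"
    and "Bt = B - fcalc (qdilog h) (- Z + scal (\<i> * of_real \<phi>))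
                - fcalc (qdilog h) (- Z - scal (\<i> * of_real \<phi>))"
    and "Zt = - Z"
    and "X = Xm scal fcalc"
    and "F = Fm w"
    and "\<Omega> = Omega w a c"
  shows "X A ** Lm ** X Z ** scal_matrix scal (F ** \<Omega>) ** X Z ** Lm ** X B
         = smult_matrix (scal (inverse qhalf))
             (X At ** Rm ** X Zt ** scal_matrix scal (- \<Omega>) ** X Zt ** Rm ** X Bt)
    \<and> X A ** Lm ** X Z ** scal_matrix scal \<Omega> ** X Z ** Rm ** X A
         = X At ** Rm ** X Zt ** scal_matrix scal \<Omega> ** X Zt ** Lm ** X At
    \<and> X B ** Rm ** X Z ** scal_matrix scal \<Omega> ** X Z ** Lm ** X B
         = X Bt ** Lm ** X Zt ** scal_matrix scal \<Omega> ** X Zt ** Rm ** X Bt"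
proof -
  interpret quantum_fat_graph D rot opp ordp h scal adj fcalc Zq by fact
  define \<tau> where "\<tau> = \<i> * of_real pi * of_real h"
  have D: "opp d \<in> D" "rot (opp d) \<in> D" "rot (rot (opp d)) \<in> D"
    using assms(2) by (simp_all add: opp_closed rot_closed)
  have edges: "edge opp g \<in> edges D opp" if "g \<in> D" for g
    using that by (simp add: edges_def)
  have span: "scal (of_real r) * Zq (edge opp g) \<in> real_span scal (Zq ` edges D opp)" if "g \<in> D" for r g
    using edges[OF that] finite_darts by (intro scaled_mem_real_span scal_zero) (auto simp: edges_def)
  have Z: "Z \<in> real_span scal (Zq ` edges D opp)"
    using span[OF assms(2), of 1] by (simp add: scal_one assms(10))
  \<comment> \<open>An order of at least 2 gives \<open>\<phi> \<le> pi / 2\<close>, well below the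
    bound \<open>pi\<close> that keeps the shifts by \<open>\<tau>\<close> inside the strip.\<close>
  have "ordp d \<ge> 2" using orbifold_order assms(2,3) by blast
  then have \<phi>: "0 \<le> \<phi>" "\<phi> < pi" using assms(6,7) by (auto simp: divide_less_eq)
  have comm: "A * Z - Z * A = scal (- 2 * \<tau>)" "B * Z - Z * B = scal (2 * \<tau>)"
    using commutator[OF edges[OF D(2)] edges[OF assms(2)]] commutator[OF edges[OF D(3)] edges[OF assms(2)]]
    unfolding bracket_pending[OF assms(2-5)] assms(10-12) by (simp_all add: \<tau>_def mult_ac)
  have qhalf: "qhalf = exp (\<tau> / 2)" using assms(9) by (simp add: \<tau>_def)
  show ?thesis
    unfolding assms(15,17)
    using pending_flip_relations[OF Z span[OF D(2), folded assms(11)] span[OF D(3), folded assms(12)] comm h_pos \<phi>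
        assms(8) \<tau>_def qhalf assms(13,14,16,18)]
    by blast
qed

end
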